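(* Let $S^1=\mathbb{R}/\mathbb{Z}$ be the unit circle with normalised Lebesgue measure $dx$. Fix $\lambda>1$ and $\epsilon>0$, and let $t\mapsto f_t$, $t\in(-\epsilon,\epsilon)$, be a $C^2$ path of $C^3$ maps $f_t:S^1\to S^1$, each of which is locally $\lambda$-expanding, i.e. $|f_t'(x)|\ge\lambda$ for all $x\in S^1$, and such that $\|f_t-f_s\|_{C^3(S^1,S^1)}=O(|t-s|)$. For each $t$ let $\mu_t=\rho_t\,dx$ be the unique absolutely continuous $f_t$-invariant probability measure, whose density satisfies $\rho_t\in C^2(S^1)$. Assume that for every $t$ there is a vector field $X_t\in C^2(S^1)$ with $v_t:=\partial_s f_s|_{s=t}=X_t\circ f_t$. Let $\mathcal{L}_t$ be the transfer operator $$\mathcal{L}_t\varphi(x)=\sum_{f_t(y)=x}\frac{\varphi(y)}{|f_t'(y)|}.$$ Then, viewing $\rho_t$ as an element of $C^1(S^1)$, the map $t\mapsto\rho_t$ is differentiable on $(-\epsilon,\epsilon)$, and $$\partial_s\rho_s|_{s=t}=-(1-\mathcal{L}_t)^{-1}\big((X_t\rho_t)'\big)\qquad\text{for all }t\in(-\epsilon,\epsilon).$$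
   Context: Acting on $C^1(S^1)$, the operator $\mathcal{L}_t$ has $\rho_t$ as a fixed point, $1$ is a simple isolated eigenvalue with eigenprojection $\Pi_t\varphi=\rho_t\int\varphi\,dx$, and the rest of its spectrum lies in a disc of radius strictly less than $1$. Hence $1-\mathcal{L}_t$ is invertible on the $\mathcal{L}_t$-invariant subspace $\{\varphi\in C^1(S^1):\int\varphi\,dx=0\}$, and $(1-\mathcal{L}_t)^{-1}$ in the formula denotes this inverse; the function $(X_t\rho_t)'$ belongs to this subspace since $\int (X_t\rho_t)'\,dx=0$ on the boundaryless circle. Here $'$ denotes the derivative with respect to $x$. *)

theory Defs
  imports "HOL-Analysis.Analysis"
begin

text \<open>Functions on the circle S^1 = R/Z are represented as 1-periodic functions
  real => real; maps S^1 -> S^1 are represented by their lifts F : real => real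
  with F (x+1) = F x + d for an integer degree d.\<close>

definition periodic1 :: "(real \<Rightarrow> real) \<Rightarrow> bool" where
  "periodic1 g \<longleftrightarrow> (\<forall>x. g (x + 1) = g x)"

definition is_lift :: "(real \<Rightarrow> real) \<Rightarrow> bool" where
  "is_lift F \<longleftrightarrow> (\<exists>d::int. \<forall>x. F (x + 1) = F x + of_int d)"

definition C_k :: "nat \<Rightarrow> (real \<Rightarrow> real) \<Rightarrow> bool" where
  "C_k k g \<longleftrightarrow> (\<forall>j<k. \<forall>x. ((deriv ^^ j) g) differentiable (at x))
                 \<and> continuous_on UNIV ((deriv ^^ k) g)"

definition Ck_norm :: "nat \<Rightarrow> (real \<Rightarrow> real) \<Rightarrow> real" where
  "Ck_norm k g = (SUP p \<in> {..k} \<times> {0..1}. \<bar>(deriv ^^ fst p) g (snd p)\<bar>)"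

definition has_Ck_path_deriv ::
  "nat \<Rightarrow> (real \<Rightarrow> real \<Rightarrow> real) \<Rightarrow> (real \<Rightarrow> real) \<Rightarrow> real \<Rightarrow> real set \<Rightarrow> bool" where
  "has_Ck_path_deriv k p D t I \<longleftrightarrow>
     ((\<lambda>s. Ck_norm k (\<lambda>x. (p s x - p t x) / (s - t) - D x)) \<longlongrightarrow> 0) (at t within I)"

definition C2_path_in_Ck :: "nat \<Rightarrow> (real \<Rightarrow> real \<Rightarrow> real) \<Rightarrow> real set \<Rightarrow> bool" where
  "C2_path_in_Ck k p I \<longleftrightarrow>
     (\<exists>q r. (\<forall>t\<in>I. C_k k (q t) \<and> periodic1 (q t) \<and> C_k k (r t) \<and> periodic1 (r t)
               \<and> has_Ck_path_deriv k p (q t) t I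
               \<and> has_Ck_path_deriv k q (r t) t I
               \<and> ((\<lambda>s. Ck_norm k (\<lambda>x. r s x - r t x)) \<longlongrightarrow> 0) (at t within I)))"

definition transfer :: "(real \<Rightarrow> real) \<Rightarrow> (real \<Rightarrow> real) \<Rightarrow> real \<Rightarrow> real" where
  "transfer F \<phi> x = (\<Sum>y\<in>{y\<in>{0..<1}. F y - x \<in> \<int>}. \<phi> y / \<bar>deriv F y\<bar>)"

definition zero_mean_inverse ::
  "((real \<Rightarrow> real) \<Rightarrow> real \<Rightarrow> real) \<Rightarrow> (real \<Rightarrow> real) \<Rightarrow> real \<Rightarrow> real" where
  "zero_mean_inverse L \<psi> = (THE \<phi>. C_k 1 \<phi> \<and> periodic1 \<phi> \<and> integral {0..1} \<phi> = 0
                                  \<and> (\<forall>x. \<phi> x - L \<phi> x = \<psi> x))"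

end

theory Submission
  imports Defs
begin

text \<open>
  Write \<open>g\<^sub>s\<close> for the inverse of the lift \<open>f\<^sub>s\<close>; then \<open>\<L>\<^sub>s \<phi> (x)\<close> is the sum of
  \<open>\<phi> (g\<^sub>s (x + k)) * \<bar>g\<^sub>s' (x + k)\<bar>\<close> over \<open>k < N\<close>, where \<open>N\<close> is the absolute value of the degree.

  The operator contracts the cones \<open>{\<phi> \<ge> 0. \<bar>\<phi>'\<bar> \<le> a \<phi>}\<close>: if \<open>h\<close> lies in the cone and has mean
  \<open>m\<close>, so does \<open>\<L>\<^sub>s h - c m\<close>, with mean \<open>(1 - c) m\<close>. Writing a zero-mean function as a difference of two
  cone elements of equal mean shows that the powers of \<open>\<L>\<^sub>s\<close> decay exponentially on zero-mean \<open>C\<^sup>1\<close>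
  functions. The constants depend only on the expansion \<open>lam\<close> and a bound for the second derivative, so
  \<open>1 - \<L>\<^sub>s\<close> is invertible there with an inverse bounded uniformly in \<open>s\<close>.

  With \<open>\<eta> = (1 - \<L>\<^sub>t)\<inverse> (X\<^sub>t \<rho>\<^sub>t)'\<close> the function \<open>h\<^sub>s = (\<rho>\<^sub>s - \<rho>\<^sub>t) / (s - t) + \<eta>\<close> satisfies
  \<open>(1 - \<L>\<^sub>s) h\<^sub>s = ((\<L>\<^sub>s \<rho>\<^sub>t - \<L>\<^sub>t \<rho>\<^sub>t) / (s - t) + (X\<^sub>t \<rho>\<^sub>t)') - (\<L>\<^sub>s \<eta> - \<L>\<^sub>t \<eta>)\<close>. Only the fixed
  functions \<open>\<rho>\<^sub>t\<close> and \<open>\<eta>\<close> occur on the right, so both terms tend to \<open>0\<close> in \<open>C\<^sup>1\<close> by joint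
  smoothness of \<open>g\<^sub>s (x)\<close>, and the uniform bound on the inverse gives \<open>h\<^sub>s \<rightarrow> 0\<close>.
\<close>

section \<open>Periodic functions\<close>

definition C1_periodic :: "(real \<Rightarrow> real) \<Rightarrow> bool" where
  "C1_periodic \<phi> \<longleftrightarrow> C_k 1 \<phi> \<and> periodic1 \<phi>"

lemma C_k_1_iff:
  "C_k 1 \<phi> \<longleftrightarrow> (\<forall>x. \<phi> differentiable (at x)) \<and> continuous_on UNIV (deriv \<phi>)"
  by (simp add: C_k_def)

lemma C1_periodicI:
  assumes "periodic1 \<phi>" "\<And>x. (\<phi> has_real_derivative \<phi>' x) (at x)" "continuous_on UNIV \<phi>'"
  shows "C1_periodic \<phi>"
proof -
  have "deriv \<phi> = \<phi>'"
    using assms(2) by (auto simp: DERIV_imp_deriv)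
  then show ?thesis
    using assms unfolding C1_periodic_def C_k_1_iff by (auto simp: real_differentiable_def)
qed

lemma C1_periodic_DERIV:
  "C1_periodic \<phi> \<Longrightarrow> (\<phi> has_real_derivative deriv \<phi> x) (at x)"
  unfolding C1_periodic_def C_k_1_iff by (simp add: DERIV_deriv_iff_real_differentiable)

lemma C1_periodic_continuous_deriv: "C1_periodic \<phi> \<Longrightarrow> continuous_on UNIV (deriv \<phi>)"
  unfolding C1_periodic_def C_k_1_iff by simp

lemma C1_periodic_imp_continuous: "C1_periodic \<phi> \<Longrightarrow> continuous_on A \<phi>"
  by (meson C1_periodic_DERIV DERIV_isCont continuous_at_imp_continuous_on)

lemma C1_periodic_imp_periodic: "C1_periodic \<phi> \<Longrightarrow> periodic1 \<phi>"
  by (simp add: C1_periodic_def)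

lemma periodic1_add_nat: "periodic1 \<phi> \<Longrightarrow> \<phi> (x + real n) = \<phi> x"
proof (induction n)
  case (Suc n)
  have "\<phi> (x + real (Suc n)) = \<phi> ((x + real n) + 1)"
    by (simp add: algebra_simps)
  then show ?case
    using Suc by (simp add: periodic1_def)
qed simp

lemma periodic1_add_int:
  assumes "periodic1 \<phi>" shows "\<phi> (x + of_int n) = \<phi> x"
proof (cases "n \<ge> 0")
  case True
  then show ?thesis
    using periodic1_add_nat[OF assms, of x "nat n"] by simp
next
  case False
  then show ?thesis
    using periodic1_add_nat[OF assms, of "x + of_int n" "nat (- n)"] by simp
qed

lemma periodic1_frac: "periodic1 \<phi> \<Longrightarrow> \<phi> (frac x) = \<phi> x"
  using periodic1_add_int[of \<phi> x "- \<lfloor>x\<rfloor>"] by (simp add: frac_def)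

lemma periodic1_ball:
  assumes "periodic1 \<phi>" "\<And>x. x \<in> {0..1} \<Longrightarrow> P (\<phi> x)" shows "P (\<phi> x)"
proof -
  have "frac x \<in> {0..1}"
    using frac_lt_1[of x] by (simp add: less_imp_le)
  then show ?thesis
    using assms by (metis periodic1_frac)
qed

text \<open>The integer increment of a lift disappears on differentiation, so one rule covers
  periodic functions and lifts of circle maps.\<close>

lemma periodic1_deriv:
  assumes "is_lift \<phi>" "\<And>x. (\<phi> has_real_derivative \<phi>' x) (at x)" shows "periodic1 \<phi>'"
  unfolding periodic1_def
proof
  fix x
  obtain d :: int where d: "\<And>x. \<phi> (x + 1) = \<phi> x + of_int d"
    using assms(1) by (auto simp: is_lift_def)
  have "((\<lambda>x. \<phi> (x + 1) - of_int d) has_real_derivative \<phi>' (x + 1)) (at x)"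
    by (auto intro!: derivative_eq_intros DERIV_chain2[OF assms(2)])
  then show "\<phi>' (x + 1) = \<phi>' x"
    using assms(2)[of x] by (simp add: d DERIV_unique)
qed

lemma periodic1_imp_is_lift: "periodic1 \<phi> \<Longrightarrow> is_lift \<phi>"
  by (auto simp: periodic1_def is_lift_def intro!: exI[of _ 0])

lemma C1_periodic_diff:
  assumes "C1_periodic \<phi>" "C1_periodic \<psi>"
  shows "C1_periodic (\<lambda>x. \<phi> x - \<psi> x)" "deriv (\<lambda>x. \<phi> x - \<psi> x) = (\<lambda>x. deriv \<phi> x - deriv \<psi> x)"
proof -
  have D: "((\<lambda>x. \<phi> x - \<psi> x) has_real_derivative deriv \<phi> x - deriv \<psi> x) (at x)" for x
    by (intro derivative_intros C1_periodic_DERIV assms)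
  show "deriv (\<lambda>x. \<phi> x - \<psi> x) = (\<lambda>x. deriv \<phi> x - deriv \<psi> x)"
    using D by (auto simp: DERIV_imp_deriv)
  show "C1_periodic (\<lambda>x. \<phi> x - \<psi> x)"
    using assms
    by (intro C1_periodicI[OF _ D] continuous_intros C1_periodic_continuous_deriv)
       (auto simp: C1_periodic_def periodic1_def)
qed

lemma C1_periodic_cmult:
  assumes "C1_periodic \<phi>"
  shows "C1_periodic (\<lambda>x. c * \<phi> x)" "deriv (\<lambda>x. c * \<phi> x) = (\<lambda>x. c * deriv \<phi> x)"
proof -
  have D: "((\<lambda>x. c * \<phi> x) has_real_derivative c * deriv \<phi> x) (at x)" for x
    by (intro DERIV_cmult C1_periodic_DERIV assms)
  show "deriv (\<lambda>x. c * \<phi> x) = (\<lambda>x. c * deriv \<phi> x)"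
    using D by (auto simp: DERIV_imp_deriv)
  show "C1_periodic (\<lambda>x. c * \<phi> x)"
    using assms
    by (intro C1_periodicI[OF _ D] continuous_intros C1_periodic_continuous_deriv)
       (auto simp: C1_periodic_def periodic1_def)
qed

lemma C1_periodic_const: "C1_periodic (\<lambda>x. c)"
  by (rule C1_periodicI[of _ "\<lambda>_. 0"]) (auto simp: periodic1_def)

lemma C1_periodic_diff_const:
  assumes "C1_periodic \<phi>"
  shows "C1_periodic (\<lambda>x. \<phi> x - c)" "deriv (\<lambda>x. \<phi> x - c) = deriv \<phi>"
  using C1_periodic_diff[OF assms C1_periodic_const[of c]] by simp_all

lemma periodic1_bounded:
  assumes "continuous_on UNIV \<phi>" "periodic1 \<phi>"
  obtains B where "0 \<le> B" "\<And>x. \<bar>\<phi> x\<bar> \<le> B"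
proof -
  have "compact (\<phi> ` {0..1})"
    by (intro compact_continuous_image continuous_on_subset[OF assms(1)]) auto
  then obtain B where B: "\<forall>y\<in>\<phi> ` {0..1}. \<bar>y\<bar> \<le> B"
    using compact_imp_bounded bounded_real by blast
  have "\<bar>\<phi> x\<bar> \<le> B" for x
    by (rule periodic1_ball[OF assms(2), where P="\<lambda>y. \<bar>y\<bar> \<le> B"]) (use B in auto)
  moreover from this[of 0] have "0 \<le> B"
    by linarith
  ultimately show ?thesis
    using that by blast
qed

lemma C1_periodic_bounded:
  assumes "C1_periodic \<phi>"
  obtains B where "0 \<le> B" "\<And>x. \<bar>\<phi> x\<bar> \<le> B" "\<And>x. \<bar>deriv \<phi> x\<bar> \<le> B"
proof -
  note per = C1_periodic_imp_periodic[OF assms]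
  have "periodic1 (deriv \<phi>)"
    by (rule periodic1_deriv[OF periodic1_imp_is_lift[OF per] C1_periodic_DERIV[OF assms]])
  then obtain B2 where B2: "0 \<le> B2" "\<And>x. \<bar>deriv \<phi> x\<bar> \<le> B2"
    using periodic1_bounded[OF C1_periodic_continuous_deriv[OF assms]] by blast
  obtain B1 where B1: "0 \<le> B1" "\<And>x. \<bar>\<phi> x\<bar> \<le> B1"
    using periodic1_bounded[OF C1_periodic_imp_continuous[OF assms] per] by blast
  show ?thesis
  proof (rule that[of "max B1 B2"])
    show "\<bar>\<phi> x\<bar> \<le> max B1 B2" "\<bar>deriv \<phi> x\<bar> \<le> max B1 B2" for x
      using B1(2)[of x] B2(2)[of x] by auto
  qed (use B1 in auto)
qed

section \<open>Antiderivatives and integrals over one period\<close>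

lemma antiderivative_UNIV:
  assumes "continuous_on UNIV (\<phi> :: real \<Rightarrow> real)"
  obtains \<Phi> where "\<And>x. (\<Phi> has_real_derivative \<phi> x) (at x)"
proof -
  \<comment> \<open>Infinite endpoints give an antiderivative on the whole line, as required for
    composing it with the inverse lift, whose values leave the unit interval.\<close>
  have "\<exists>F. \<forall>x::real. -\<infinity> < ereal x \<longrightarrow> ereal x < \<infinity> \<longrightarrow> (F has_vector_derivative \<phi> x) (at x)"
    using assms by (intro einterval_antiderivative) (auto simp: continuous_on_eq_continuous_at)
  then show ?thesis
    using that by (auto simp: has_real_derivative_iff_has_vector_derivative)
qed

lemma FTC_unit_interval:
  assumes "\<And>x. (\<Phi> has_real_derivative \<phi> x) (at x)"
  shows "(\<phi> has_integral \<Phi> 1 - \<Phi> (0::real)) {0..1}"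
  by (rule fundamental_theorem_of_calculus)
     (auto simp: has_real_derivative_iff_has_vector_derivative[symmetric]
           intro: has_field_derivative_at_within assms)

text \<open>The increment over one period has derivative zero, so it may be evaluated at
  \<open>0\<close>.\<close>

lemma periodic_antiderivative_shift:
  assumes "periodic1 \<phi>" "\<And>x. (\<Phi> has_real_derivative \<phi> x) (at x)"
  shows "\<Phi> (x + 1) - \<Phi> x = integral {0..1} \<phi>"
proof -
  have "((\<lambda>x. \<Phi> (x + 1) - \<Phi> x) has_real_derivative 0) (at x)" for x
    using assms(1) by (auto intro!: derivative_eq_intros DERIV_chain2[OF assms(2)] assms(2)
        simp: periodic1_def)
  then have "\<Phi> (x + 1) - \<Phi> x = \<Phi> (0 + 1) - \<Phi> 0"
    by (intro DERIV_isconst_all) blast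
  then show ?thesis
    using integral_unique[OF FTC_unit_interval[OF assms(2)]] by simp
qed

section \<open>Functions of class \<open>C^k\<close> and their norms\<close>

lemma C_k_DERIV:
  assumes "C_k k h" "j < k"
  shows "((deriv ^^ j) h has_real_derivative (deriv ^^ Suc j) h x) (at x)"
  using assms by (simp add: C_k_def DERIV_deriv_iff_real_differentiable)

lemma C_k_continuous:
  assumes "C_k k h" "j \<le> k" shows "continuous_on A ((deriv ^^ j) h)"
proof (cases "j < k")
  case True
  from DERIV_isCont[OF C_k_DERIV[OF assms(1) this]] show ?thesis
    by (simp add: continuous_at_imp_continuous_on)
next
  case False
  then show ?thesis
    using assms by (auto simp: C_k_def intro: continuous_on_subset)
qed

lemma C_k_periodic_deriv:
  assumes "C_k k h" "periodic1 h" "j \<le> k" shows "periodic1 ((deriv ^^ j) h)"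
  using assms(3)
proof (induction j)
  case (Suc j)
  then have "periodic1 ((deriv ^^ j) h)"
    by simp
  moreover have "((deriv ^^ j) h has_real_derivative (deriv ^^ Suc j) h x) (at x)" for x
    by (rule C_k_DERIV[OF assms(1)]) (use Suc.prems in simp)
  ultimately show ?case
    by (rule periodic1_deriv[OF periodic1_imp_is_lift])
qed (simp add: assms)

text \<open>The iterated \<open>deriv\<close> is computed first, by induction from the derivatives
  of \<open>u\<close> and \<open>v\<close>; differentiability of the combination is then read off
  from the formula.\<close>

lemma C_k_lincomb:
  assumes u: "C_k k u" and v: "C_k k v"
  shows "C_k k (\<lambda>x. a * u x + b * v x)"
    and "j \<le> k \<Longrightarrow> (deriv ^^ j) (\<lambda>x. a * u x + b * v x) = (\<lambda>x. a * (deriv ^^ j) u x + b * (deriv ^^ j) v x)"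
proof -
  have D: "((\<lambda>x. a * (deriv ^^ j) u x + b * (deriv ^^ j) v x) has_real_derivative
      a * (deriv ^^ Suc j) u x + b * (deriv ^^ Suc j) v x) (at x)" if "j < k" for j x
    by (intro DERIV_add DERIV_cmult C_k_DERIV[OF u that] C_k_DERIV[OF v that])
  show *: "(deriv ^^ j) (\<lambda>x. a * u x + b * v x) = (\<lambda>x. a * (deriv ^^ j) u x + b * (deriv ^^ j) v x)"
    if "j \<le> k" for j
    using that
  proof (induction j)
    case (Suc j)
    then have "(deriv ^^ Suc j) (\<lambda>x. a * u x + b * v x) = deriv (\<lambda>x. a * (deriv ^^ j) u x + b * (deriv ^^ j) v x)"
      by simp
    also have "\<dots> = (\<lambda>x. a * (deriv ^^ Suc j) u x + b * (deriv ^^ Suc j) v x)"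
      using DERIV_imp_deriv[OF D[of j]] Suc.prems by (intro ext) simp
    finally show ?case .
  qed simp
  show "C_k k (\<lambda>x. a * u x + b * v x)"
    unfolding C_k_def
  proof (intro conjI allI impI)
    show "(deriv ^^ j) (\<lambda>x. a * u x + b * v x) differentiable at x" if "j < k" for j x
      using D[OF that, of x] *[of j] that by (auto simp: real_differentiable_def)
    show "continuous_on UNIV ((deriv ^^ k) (\<lambda>x. a * u x + b * v x))"
      unfolding *[OF order_refl] by (intro continuous_intros C_k_continuous[OF u] C_k_continuous[OF v]) auto
  qed
qed

text \<open>A real supremum bounds its terms only if the set is bounded above. Compactness bounds
  each derivative on \<open>{0..1}\<close>, the finitely many orders share a maximum, and
  periodicity reaches every real \<open>x\<close>.\<close>

lemma Ck_norm_ge: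
  assumes "C_k k h" "periodic1 h" "j \<le> k"
  shows "\<bar>(deriv ^^ j) h x\<bar> \<le> Ck_norm k h"
proof -
  have "\<exists>b. \<forall>x\<in>{0..1}. \<bar>(deriv ^^ i) h x\<bar> \<le> b" if "i \<le> k" for i
    using compact_imp_bounded[OF compact_continuous_image[OF C_k_continuous[OF assms(1) that] compact_Icc]]
    by (auto simp: bounded_real)
  then obtain b where b: "\<And>i x. i \<le> k \<Longrightarrow> x \<in> {0..1} \<Longrightarrow> \<bar>(deriv ^^ i) h x\<bar> \<le> b i"
    by metis
  have bdd: "bdd_above ((\<lambda>p. \<bar>(deriv ^^ fst p) h (snd p)\<bar>) ` ({..k} \<times> {0..1}))"
  proof (rule bdd_aboveI2)
    fix p :: "nat \<times> real" assume p: "p \<in> {..k} \<times> {0..1}"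
    then have "\<bar>(deriv ^^ fst p) h (snd p)\<bar> \<le> b (fst p)"
      using b by auto
    also have "\<dots> \<le> Max (b ` {..k})"
      using p by (intro Max_ge) auto
    finally show "\<bar>(deriv ^^ fst p) h (snd p)\<bar> \<le> Max (b ` {..k})" .
  qed
  have "\<bar>(deriv ^^ j) h x\<bar> \<le> Ck_norm k h" if "x \<in> {0..1}" for x
    using cSUP_upper[OF _ bdd, of "(j, x)"] that assms(3) by (simp add: Ck_norm_def)
  then show ?thesis
    using periodic1_ball[OF C_k_periodic_deriv[OF assms], where P="\<lambda>y. \<bar>y\<bar> \<le> Ck_norm k h"] by blast
qed

lemma Ck_norm_1_le:
  assumes "\<And>x. x \<in> {0..1} \<Longrightarrow> \<bar>h x\<bar> \<le> b" "\<And>x. x \<in> {0..1} \<Longrightarrow> \<bar>deriv h x\<bar> \<le> b"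
  shows "Ck_norm 1 h \<le> b"
  unfolding Ck_norm_def
proof (rule cSUP_least)
  fix p :: "nat \<times> real" assume "p \<in> {..1} \<times> {0..1}"
  then have "fst p = 0 \<or> fst p = 1" "snd p \<in> {0..1}"
    by auto
  then show "\<bar>(deriv ^^ fst p) h (snd p)\<bar> \<le> b"
    using assms[of "snd p"] by auto
qed auto

lemma C_k_2_imp_C1_periodic:
  assumes "C_k 2 h" "periodic1 h" shows "C1_periodic h" "C1_periodic (deriv h)"
proof -
  have p: "periodic1 (deriv h)"
    using C_k_periodic_deriv[OF assms, of 1] by simp
  show "C1_periodic h"
    using C_k_DERIV[OF assms(1), of 0] C_k_continuous[OF assms(1), of 1]
    by (intro C1_periodicI[OF assms(2)]) simp_all
  show "C1_periodic (deriv h)"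
    using C_k_DERIV[OF assms(1), of 1] C_k_continuous[OF assms(1), of 2]
    by (intro C1_periodicI[OF p, of "(deriv ^^ 2) h"]) (simp_all add: numeral_2_eq_2)
qed

section \<open>Cone contraction\<close>

text \<open>Where \<open>\<phi>\<close> is positive, the inequality says that
  \<open>ln \<phi>\<close> has Lipschitz constant \<open>a\<close>. The mean is recorded as a
  parameter so that elements of equal mean can be subtracted from each other.\<close>

definition cone :: "real \<Rightarrow> real \<Rightarrow> (real \<Rightarrow> real) \<Rightarrow> bool" where
  "cone a m \<phi> \<longleftrightarrow> C1_periodic \<phi> \<and> (\<forall>x. 0 \<le> \<phi> x \<and> \<bar>deriv \<phi> x\<bar> \<le> a * \<phi> x)
     \<and> integral {0..1} \<phi> = m"

text \<open>A Gronwall argument: the cone condition makes \<open>\<phi> x * exp (- a * x)\<close>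
  nonincreasing and \<open>\<phi> x * exp (a * x)\<close> nondecreasing. No logarithm is taken, so
  zeros of \<open>\<phi>\<close> are harmless; points of the unit interval are at distance at most
  1.\<close>

lemma cone_oscillation:
  assumes "cone a m \<phi>" "0 \<le> a" "x \<in> {0..1}" "y \<in> {0..1}"
  shows "\<phi> x \<le> exp a * \<phi> y"
proof -
  note D = C1_periodic_DERIV[of \<phi>]
  have C: "C1_periodic \<phi>" and d: "\<bar>deriv \<phi> x\<bar> \<le> a * \<phi> x" and p: "0 \<le> \<phi> x" for x
    using assms(1) by (auto simp: cone_def)
  have up: "\<phi> v \<le> exp (a * (v - u)) * \<phi> u" if "u \<le> v" for u v
  proof -
    have "\<phi> v * exp (- a * v) \<le> \<phi> u * exp (- a * u)"
    proof (rule DERIV_nonpos_imp_nonincreasing[OF that])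
      fix x
      have "((\<lambda>x. \<phi> x * exp (- a * x)) has_real_derivative (deriv \<phi> x - a * \<phi> x) * exp (- a * x)) (at x)"
        by (auto intro!: derivative_eq_intros D C simp: algebra_simps)
      moreover have "(deriv \<phi> x - a * \<phi> x) * exp (- a * x) \<le> 0"
        using d[of x] by (intro mult_nonpos_nonneg) auto
      ultimately show "\<exists>y. ((\<lambda>x. \<phi> x * exp (- a * x)) has_real_derivative y) (at x) \<and> y \<le> 0"
        by blast
    qed
    then show ?thesis
      by (simp add: right_diff_distrib exp_diff exp_minus field_simps)
  qed
  have down: "\<phi> u \<le> exp (a * (v - u)) * \<phi> v" if "u \<le> v" for u v
  proof -
    have "\<phi> u * exp (a * u) \<le> \<phi> v * exp (a * v)"
    proof (rule DERIV_nonneg_imp_nondecreasing[OF that])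
      fix x
      have "((\<lambda>x. \<phi> x * exp (a * x)) has_real_derivative (deriv \<phi> x + a * \<phi> x) * exp (a * x)) (at x)"
        by (auto intro!: derivative_eq_intros D C simp: algebra_simps)
      moreover have "(deriv \<phi> x + a * \<phi> x) * exp (a * x) \<ge> 0"
        using d[of x] by (intro mult_nonneg_nonneg) auto
      ultimately show "\<exists>y. ((\<lambda>x. \<phi> x * exp (a * x)) has_real_derivative y) (at x) \<and> y \<ge> 0"
        by blast
    qed
    then show ?thesis
      by (simp add: right_diff_distrib exp_diff exp_minus field_simps)
  qed
  have "\<phi> x \<le> exp (a * \<bar>x - y\<bar>) * \<phi> y"
    using up[of y x] down[of x y] by (cases "x \<le> y") (auto simp: abs_real_def)
  also have "\<dots> \<le> exp a * \<phi> y"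
    using assms(2-4) p by (intro mult_right_mono) (auto simp: abs_real_def intro!: mult_left_le)
  finally show ?thesis .
qed

text \<open>Integrating the oscillation estimate over one of its two points replaces the value there
  by the mean \<open>m\<close>; periodicity carries the bounds to the whole line.\<close>

lemma cone_bounds:
  assumes "cone a m \<phi>" "0 \<le> a"
  shows "\<phi> x \<le> exp a * m" "exp (- a) * m \<le> \<phi> x" "\<bar>deriv \<phi> x\<bar> \<le> a * exp a * m"
proof -
  have C: "C1_periodic \<phi>" and m: "integral {0..1} \<phi> = m"
    and d: "\<And>x. \<bar>deriv \<phi> x\<bar> \<le> a * \<phi> x"
    using assms(1) by (auto simp: cone_def)
  have i: "(\<phi> has_integral m) {0..1}"
    using m C1_periodic_imp_continuous[OF C, of "{0..1}"]
    by (metis integrable_continuous_real integrable_integral)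
  have "\<phi> x \<le> exp a * m \<and> exp (- a) * m \<le> \<phi> x" if x: "x \<in> {0..1}" for x
  proof
    show "\<phi> x \<le> exp a * m"
      using has_integral_le[OF has_integral_const_real[of "\<phi> x" 0 1] has_integral_mult_right[OF i, of "exp a"]]
        cone_oscillation[OF assms] x by simp
    have "m \<le> exp a * \<phi> x"
      using has_integral_le[OF i has_integral_const_real[of "exp a * \<phi> x" 0 1]]
        cone_oscillation[OF assms _ x] by simp
    then show "exp (- a) * m \<le> \<phi> x"
      by (simp add: exp_minus field_simps)
  qed
  then show *: "\<phi> x \<le> exp a * m" "exp (- a) * m \<le> \<phi> x" for x
    using periodic1_ball[OF C1_periodic_imp_periodic[OF C], of "\<lambda>y. y \<le> exp a * m \<and> exp (- a) * m \<le> y" x]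
    by blast+
  show "\<bar>deriv \<phi> x\<bar> \<le> a * exp a * m"
    using d[of x] mult_left_mono[OF *(1)[of x] assms(2)] by (simp add: mult.assoc)
qed

text \<open>\<open>g\<close> models the inverse of a lift of degree \<open>\<sigma> * N\<close>, so
  \<open>g (x + k)\<close> for \<open>k < N\<close> are the inverse branches. The factor
  \<open>\<sigma>\<close> turns \<open>g1\<close> into its absolute value, which treats both
  orientations together; \<open>D\<close> bounds the distortion.\<close>

locale expanding_branches =
  fixes g g1 g2 :: "real \<Rightarrow> real" and \<sigma> \<theta> D :: real and N :: nat
  assumes g_DERIV: "(g has_real_derivative g1 x) (at x)"
    and g1_DERIV: "(g1 has_real_derivative g2 x) (at x)"
    and g2_continuous: "continuous_on UNIV g2"
    and g_shift: "g (x + real N) = g x + \<sigma>"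
    and sign: "\<sigma> = 1 \<or> \<sigma> = - 1"
    and g1_pos: "0 < \<sigma> * g1 x"
    and g1_le: "\<sigma> * g1 x \<le> \<theta>"
    and theta: "\<theta> < 1"
    and distortion: "\<bar>g2 x\<bar> \<le> D * (\<sigma> * g1 x)"
begin

definition L :: "(real \<Rightarrow> real) \<Rightarrow> real \<Rightarrow> real" where
  "L \<phi> x = (\<Sum>k<N. \<phi> (g (x + real k)) * (\<sigma> * g1 (x + real k)))"

definition L' :: "(real \<Rightarrow> real) \<Rightarrow> real \<Rightarrow> real" where
  "L' \<phi> x = (\<Sum>k<N. deriv \<phi> (g (x + real k)) * (\<sigma> * (g1 (x + real k))\<^sup>2)
                    + \<phi> (g (x + real k)) * (\<sigma> * g2 (x + real k)))"

lemma g_continuous: "continuous_on A g" and g1_continuous: "continuous_on A g1"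
  using g_DERIV g1_DERIV by (meson DERIV_isCont continuous_at_imp_continuous_on)+

lemma D_nonneg: "0 \<le> D"
  using distortion[of 0] g1_pos[of 0] by (smt (verit) mult_neg_pos)

lemma g1_shift: "g1 (x + real N) = g1 x"
proof -
  have "((\<lambda>x. g (x + real N) - \<sigma>) has_real_derivative g1 (x + real N)) (at x)"
    by (auto intro!: derivative_eq_intros DERIV_chain2[OF g_DERIV])
  then show ?thesis
    using g_DERIV[of x] by (simp add: g_shift DERIV_unique)
qed

lemma periodic_shift_sign:
  assumes "periodic1 \<phi>" shows "\<phi> (x + \<sigma>) = \<phi> x"
  using sign periodic1_add_int[OF assms, of x 1] periodic1_add_int[OF assms, of x "-1"] by auto

text \<open>Moving \<open>x\<close> to \<open>x + 1\<close> moves every branch to the next one, so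
  only the end terms survive. Both the periodicity of \<open>L \<phi>\<close> and the preservation
  of integrals rest on this.\<close>

lemma sum_branches_telescope:
  fixes u :: "real \<Rightarrow> real"
  shows "(\<Sum>k<N. u (x + 1 + real k)) - (\<Sum>k<N. u (x + real k)) = u (x + real N) - u x"
  using sum_lessThan_telescope[of "\<lambda>k. u (x + real k)" N]
  by (simp add: sum_subtractf algebra_simps)

lemma L_periodic:
  assumes "periodic1 \<phi>" shows "periodic1 (L \<phi>)"
  unfolding periodic1_def L_def
  using sum_branches_telescope[of "\<lambda>y. \<phi> (g y) * (\<sigma> * g1 y)"] assms
  by (simp add: g_shift g1_shift periodic_shift_sign)

lemma L_continuous:
  assumes "continuous_on UNIV \<phi>" shows "continuous_on UNIV (L \<phi>)"
  unfolding L_def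
  by (intro continuous_intros continuous_on_compose2[OF assms] continuous_on_compose2[OF g1_continuous[of UNIV]]
      continuous_on_compose2[OF g_continuous[of UNIV]]) auto

lemma L_DERIV:
  assumes "C1_periodic \<phi>" shows "(L \<phi> has_real_derivative L' \<phi> x) (at x)"
  unfolding L_def[abs_def] L'_def
  by (auto intro!: derivative_eq_intros DERIV_chain2[OF C1_periodic_DERIV[OF assms]]
      DERIV_chain2[OF g_DERIV] DERIV_chain2[OF g1_DERIV] sum.cong
      simp: power2_eq_square algebra_simps)

lemma deriv_L: "C1_periodic \<phi> \<Longrightarrow> deriv (L \<phi>) = L' \<phi>"
  using L_DERIV by (auto simp: DERIV_imp_deriv)

lemma L_C1_periodic:
  assumes "C1_periodic \<phi>" shows "C1_periodic (L \<phi>)"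
proof (rule C1_periodicI[OF L_periodic L_DERIV])
  show "continuous_on UNIV (L' \<phi>)"
    unfolding L'_def
    by (intro continuous_intros continuous_on_compose2[OF C1_periodic_continuous_deriv[OF assms]]
        continuous_on_compose2[OF C1_periodic_imp_continuous[OF assms, of UNIV]]
        continuous_on_compose2[OF g1_continuous[of UNIV]] continuous_on_compose2[OF g2_continuous]
        continuous_on_compose2[OF g_continuous[of UNIV]]) auto
qed (use assms in \<open>auto intro: C1_periodic_imp_periodic\<close>)

text \<open>If \<open>\<Phi>\<close> is an antiderivative of \<open>\<phi>\<close>, the sum of \<open>\<sigma> * \<Phi> (g (x + k))\<close> over \<open>k < N\<close> is one of
  \<open>L \<phi>\<close>, and its increment over a period telescopes.\<close>

lemma L_integral:
  assumes "continuous_on UNIV \<phi>" "periodic1 \<phi>"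
  shows "integral {0..1} (L \<phi>) = integral {0..1} \<phi>"
proof -
  obtain \<Phi> where \<Phi>: "\<And>x. (\<Phi> has_real_derivative \<phi> x) (at x)"
    using antiderivative_UNIV[OF assms(1)] by blast
  define P where "P x = (\<Sum>k<N. \<sigma> * \<Phi> (g (x + real k)))" for x
  have "(P has_real_derivative L \<phi> x) (at x)" for x
    unfolding P_def[abs_def] L_def
    by (auto intro!: derivative_eq_intros DERIV_chain2[OF \<Phi>] DERIV_chain2[OF g_DERIV] sum.cong
        simp: algebra_simps)
  then have "integral {0..1} (L \<phi>) = P 1 - P 0"
    by (rule integral_unique[OF FTC_unit_interval])
  also have "\<dots> = \<sigma> * \<Phi> (g 0 + \<sigma>) - \<sigma> * \<Phi> (g 0)"
    using sum_branches_telescope[of "\<lambda>y. \<sigma> * \<Phi> (g y)" 0] g_shift[of 0] by (simp add: P_def)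
  \<comment> \<open>For \<open>\<sigma> = - 1\<close> the period is traversed backwards, from
    \<open>g 0\<close> to \<open>g 0 - 1\<close>, and the two signs cancel.\<close>
  also have "\<dots> = integral {0..1} \<phi>"
    using sign periodic_antiderivative_shift[OF assms(2) \<Phi>, of "g 0"]
      periodic_antiderivative_shift[OF assms(2) \<Phi>, of "g 0 - 1"] by auto
  finally show ?thesis .
qed

section \<open>Invariance of the cones under the operator\<close>

lemma L_diff: "L (\<lambda>x. \<phi> x - \<psi> x) = (\<lambda>x. L \<phi> x - L \<psi> x)"
  by (auto simp: L_def sum_subtractf algebra_simps)

lemma L_nonneg: "(\<And>x. 0 \<le> \<phi> x) \<Longrightarrow> 0 \<le> L \<phi> x"
  unfolding L_def using less_imp_le[OF g1_pos] by (intro sum_nonneg mult_nonneg_nonneg[of "\<phi> _"]) auto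

text \<open>The solution of \<open>a * \<theta> + D = a - 1\<close>. The operator turns the cone
  constant \<open>a\<close> into \<open>a * \<theta> + D\<close>, so this choice gains a full unit,
  to be spent on subtracting a constant.\<close>

definition a :: real where "a = (D + 1) / (1 - \<theta>)"

text \<open>Chosen so that \<open>a * c * m\<close> is the lower bound \<open>exp (- a) * m\<close>
  of a cone element of mean \<open>m\<close>.\<close>

definition c :: real where "c = exp (- a) / a"

lemma a_ge_1: "1 \<le> a"
proof -
  have "0 < \<theta>"
    using g1_pos[of 0] g1_le[of 0] by linarith
  then show ?thesis
    using theta D_nonneg by (simp add: a_def field_simps)
qed

lemma a_step: "a * \<theta> + D = a - 1"
  using theta by (simp add: a_def field_simps)

lemma c_bounds: "0 < c" "c < 1"
proof -
  show "0 < c"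
    using a_ge_1 by (simp add: c_def)
  have "exp (- a) < 1"
    using a_ge_1 by simp
  then have "exp (- a) < a"
    using a_ge_1 by linarith
  then show "c < 1"
    using a_ge_1 by (simp add: c_def)
qed

text \<open>The gained unit gives
  \<open>\<bar>L' \<phi>\<bar> \<le> a * L \<phi> - L \<phi>\<close>, and
  \<open>L \<phi> \<ge> a * c * m\<close>. Hence the derivative is at most
  \<open>a * (L \<phi> - c * m)\<close>, which is the cone condition after the subtraction. As
  \<open>L\<close> preserves the mean, the new mean is \<open>m - c * m\<close>.\<close>

lemma L_cone:
  assumes "cone a m \<phi>"
  shows "cone a (m * (1 - c)) (\<lambda>x. L \<phi> x - c * m)"
proof -
  have C: "C1_periodic \<phi>" and m: "integral {0..1} \<phi> = m"
    and d: "\<And>x. \<bar>deriv \<phi> x\<bar> \<le> a * \<phi> x" and p: "\<And>x. 0 \<le> \<phi> x"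
    using assms by (auto simp: cone_def)
  have a0: "0 \<le> a" and ap: "0 < a"
    using a_ge_1 by auto
  have m0: "0 \<le> m"
    using p C1_periodic_imp_continuous[OF C, of "{0..1}"] unfolding m[symmetric]
    by (intro integral_nonneg integrable_continuous_real) auto
  \<comment> \<open>Branch by branch, the chain rule term contributes \<open>a * \<theta>\<close>
    through the contraction of \<open>g\<close>, and the derivative of the weight contributes
    \<open>D\<close> through distortion.\<close>
  have le: "\<bar>L' \<phi> x\<bar> \<le> (a - 1) * L \<phi> x" for x
    unfolding L'_def L_def sum_distrib_left
  proof (rule order_trans[OF sum_abs], rule sum_mono)
    fix k
    let ?y = "x + real k"
    let ?h = "\<sigma> * g1 ?y"
    have h: "0 \<le> ?h" "?h \<le> \<theta>"
      using g1_pos g1_le by (auto intro: less_imp_le)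
    have s: "\<bar>\<sigma> * (g1 ?y)\<^sup>2\<bar> = ?h * ?h" "\<bar>\<sigma>\<bar> = 1"
      using sign by (auto simp: power2_eq_square abs_mult)
    have "\<bar>deriv \<phi> (g ?y) * (\<sigma> * (g1 ?y)\<^sup>2)\<bar> = \<bar>deriv \<phi> (g ?y)\<bar> * (?h * ?h)"
      unfolding abs_mult[of "deriv \<phi> (g ?y)"] s ..
    also have "\<dots> \<le> (a * \<phi> (g ?y)) * (\<theta> * ?h)"
      using mult_nonneg_nonneg[OF a0 p]
      by (rule mult_mono[OF d mult_right_mono[OF h(2,1)] _ mult_nonneg_nonneg[OF h(1,1)]])
    finally have 1: "\<bar>deriv \<phi> (g ?y) * (\<sigma> * (g1 ?y)\<^sup>2)\<bar> \<le> (a * \<theta>) * (\<phi> (g ?y) * ?h)"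
      by (simp add: algebra_simps)
    have "\<bar>\<phi> (g ?y) * (\<sigma> * g2 ?y)\<bar> = \<phi> (g ?y) * \<bar>g2 ?y\<bar>"
      using s p by (simp add: abs_mult)
    also have "\<dots> \<le> \<phi> (g ?y) * (D * ?h)"
      by (intro mult_left_mono distortion p)
    finally have 2: "\<bar>\<phi> (g ?y) * (\<sigma> * g2 ?y)\<bar> \<le> D * (\<phi> (g ?y) * ?h)"
      by (simp add: algebra_simps)
    have "\<bar>deriv \<phi> (g ?y) * (\<sigma> * (g1 ?y)\<^sup>2) + \<phi> (g ?y) * (\<sigma> * g2 ?y)\<bar>
        \<le> (a * \<theta> + D) * (\<phi> (g ?y) * ?h)"
      using 1 2 by (simp add: distrib_right)
    then show "\<bar>deriv \<phi> (g ?y) * (\<sigma> * (g1 ?y)\<^sup>2) + \<phi> (g ?y) * (\<sigma> * g2 ?y)\<bar>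
        \<le> (a - 1) * (\<phi> (g ?y) * ?h)"
      by (simp add: a_step)
  qed
  have Lm: "integral {0..1} (L \<phi>) = m"
    using L_integral[OF C1_periodic_imp_continuous[OF C] C1_periodic_imp_periodic[OF C]] m by simp
  \<comment> \<open>Membership before the subtraction is what supplies the pointwise lower bound on
    \<open>L \<phi>\<close>.\<close>
  have "cone a m (L \<phi>)"
    unfolding cone_def deriv_L[OF C]
  proof (intro conjI allI L_C1_periodic C L_nonneg p Lm)
    show "\<bar>L' \<phi> x\<bar> \<le> a * L \<phi> x" for x
      using le[of x] L_nonneg[of \<phi> x, OF p] by (simp add: algebra_simps)
  qed
  from cone_bounds(2)[OF this a0] have low: "a * (c * m) \<le> L \<phi> x" for x
    using ap by (simp add: c_def)
  have "c * m \<le> a * (c * m)"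
    using mult_right_mono[OF a_ge_1, of "c * m"] m0 c_bounds by simp
  with low have low1: "c * m \<le> L \<phi> x" for x
    using order_trans by blast
  have "integral {0..1} (\<lambda>x. L \<phi> x - c * m) = m - c * m"
    using C1_periodic_imp_continuous[OF L_C1_periodic[OF C], of "{0..1}"] Lm
    by (subst integral_diff) (auto intro: integrable_continuous_real)
  then show ?thesis
    unfolding cone_def C1_periodic_diff_const(2)[OF L_C1_periodic[OF C]] deriv_L[OF C]
  proof (intro conjI allI)
    fix x
    show "0 \<le> L \<phi> x - c * m"
      using low1[of x] by simp
    show "\<bar>L' \<phi> x\<bar> \<le> a * (L \<phi> x - c * m)"
      using le[of x] low[of x] by (simp add: algebra_simps)
  qed (simp_all add: C1_periodic_diff_const(1)[OF L_C1_periodic[OF C]] algebra_simps)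
qed

definition cone_difference :: "real \<Rightarrow> (real \<Rightarrow> real) \<Rightarrow> bool" where
  "cone_difference m \<phi> \<longleftrightarrow> (\<exists>h h'. cone a m h \<and> cone a m h' \<and> \<phi> = (\<lambda>x. h x - h' x))"

text \<open>The same constant \<open>c * m\<close> is subtracted from the images of both cone
  elements, so it cancels in their difference while the common mean shrinks.\<close>

lemma cone_difference_L:
  assumes "cone_difference m \<phi>" shows "cone_difference (m * (1 - c)) (L \<phi>)"
proof -
  obtain h h' where h: "cone a m h" "cone a m h'" "\<phi> = (\<lambda>x. h x - h' x)"
    using assms by (auto simp: cone_difference_def)
  show ?thesis
    unfolding cone_difference_def h(3) L_diff
    by (rule exI conjI L_cone[OF h(1)] L_cone[OF h(2)])+ simp
qed

lemma cone_difference_bounds: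
  assumes "cone_difference m \<phi>"
  shows "C1_periodic \<phi>" "\<bar>\<phi> x\<bar> \<le> 2 * a * exp a * m" "\<bar>deriv \<phi> x\<bar> \<le> 2 * a * exp a * m"
proof -
  obtain h h' where h: "cone a m h" "cone a m h'" "\<phi> = (\<lambda>x. h x - h' x)"
    using assms by (auto simp: cone_difference_def)
  have C: "C1_periodic h" "C1_periodic h'" and p: "0 \<le> h x" "0 \<le> h' x"
    using h by (auto simp: cone_def)
  have a0: "0 \<le> a"
    using a_ge_1 by simp
  note b = cone_bounds[OF h(1) a0, of x] cone_bounds[OF h(2) a0, of x]
  show "C1_periodic \<phi>"
    using C1_periodic_diff(1)[OF C] h(3) by simp
  have "\<bar>\<phi> x\<bar> \<le> exp a * m"
    using p b by (auto simp: h(3))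
  also have "\<dots> \<le> 2 * a * (exp a * m)"
    using p b a_ge_1 by (simp add: mult_le_cancel_right1)
  finally show "\<bar>\<phi> x\<bar> \<le> 2 * a * exp a * m"
    by (simp add: mult.assoc)
  show "\<bar>deriv \<phi> x\<bar> \<le> 2 * a * exp a * m"
    using b by (simp add: h(3) C1_periodic_diff(2)[OF C])
qed

section \<open>Exponential decay on zero-mean functions and the resolvent\<close>

definition K :: real where "K = 4 * a * exp a"

lemma K_nonneg: "0 \<le> K"
  using a_ge_1 by (simp add: K_def)

text \<open>Such a function is a difference of two cone elements of mean \<open>2 * B\<close>, and
  each application of \<open>L\<close> multiplies the common mean by \<open>1 - c\<close>; the cone
  bounds turn small mean into small \<open>C^1\<close> size.\<close>

lemma L_power_decay:
  assumes "C1_periodic \<phi>" "integral {0..1} \<phi> = 0" "\<And>x. \<bar>\<phi> x\<bar> \<le> B" "\<And>x. \<bar>deriv \<phi> x\<bar> \<le> B"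
  shows "C1_periodic ((L ^^ n) \<phi>)" "\<bar>(L ^^ n) \<phi> x\<bar> \<le> K * B * (1 - c) ^ n"
    "\<bar>deriv ((L ^^ n) \<phi>) x\<bar> \<le> K * B * (1 - c) ^ n"
proof -
  have B0: "0 \<le> B"
    using assms(3)[of 0] by linarith
  \<comment> \<open>Adding \<open>2 * B\<close> lifts the function to at least \<open>B\<close>,
    which dominates its derivative; since \<open>a \<ge> 1\<close> this suffices for the cone. The
    sum is written as a subtraction to match the rule for constants.\<close>
  have c1: "cone a (2 * B) (\<lambda>x. \<phi> x - (- 2 * B))"
    unfolding cone_def C1_periodic_diff_const(2)[OF assms(1)]
  proof (intro conjI allI)
    show "integral {0..1} (\<lambda>x. \<phi> x - (- 2 * B)) = 2 * B"
      using C1_periodic_imp_continuous[OF assms(1), of "{0..1}"] assms(2)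
      by (subst integral_diff) (auto intro: integrable_continuous_real)
    fix x
    have le: "B \<le> \<phi> x - (- 2 * B)"
      using assms(3)[of x] by linarith
    then show "0 \<le> \<phi> x - (- 2 * B)"
      using B0 by linarith
    have "\<bar>deriv \<phi> x\<bar> \<le> 1 * (\<phi> x - (- 2 * B))"
      using le assms(4)[of x] by simp
    also have "\<dots> \<le> a * (\<phi> x - (- 2 * B))"
      using a_ge_1 le B0 by (intro mult_right_mono) auto
    finally show "\<bar>deriv \<phi> x\<bar> \<le> a * (\<phi> x - (- 2 * B))" .
  qed (rule C1_periodic_diff_const(1)[OF assms(1)])
  have c2: "cone a (2 * B) (\<lambda>x. 2 * B)"
    using B0 a_ge_1 by (auto simp: cone_def C1_periodic_const)
  have "cone_difference (2 * B * (1 - c) ^ n) ((L ^^ n) \<phi>)"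
  proof (induction n)
    case 0
    have "cone_difference (2 * B) \<phi>"
      unfolding cone_difference_def by (rule exI conjI c1 c2)+ simp
    then show ?case by simp
  next
    case (Suc n)
    then show ?case
      using cone_difference_L[OF Suc] by (simp add: mult_ac)
  qed
  \<comment> \<open>The factor \<open>2 * a * exp a\<close> of the difference bounds and the
    \<open>2\<close> of the initial mean multiply to \<open>K\<close>.\<close>
  from cone_difference_bounds[OF this]
  show "C1_periodic ((L ^^ n) \<phi>)" "\<bar>(L ^^ n) \<phi> x\<bar> \<le> K * B * (1 - c) ^ n"
    "\<bar>deriv ((L ^^ n) \<phi>) x\<bar> \<le> K * B * (1 - c) ^ n"
    by (simp_all add: K_def mult_ac)
qed

lemma L_power_integral:
  assumes "C1_periodic \<phi>"
  shows "C1_periodic ((L ^^ n) \<phi>)" "integral {0..1} ((L ^^ n) \<phi>) = integral {0..1} \<phi>"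
  by (induction n)
     (auto simp: assms L_C1_periodic L_integral C1_periodic_imp_continuous C1_periodic_imp_periodic)

text \<open>With \<open>\<psi> = \<phi> - L \<phi>\<close> the sum of the iterates of
  \<open>\<psi>\<close> telescopes to \<open>\<phi>\<close> minus a decaying remainder, and the
  decay estimate for \<open>\<psi>\<close> is summed as a geometric series. The factor
  \<open>K / c\<close> depends on \<open>\<theta>\<close> and \<open>D\<close> only, which later
  gives uniformity in the parameter.\<close>

lemma resolvent_bound:
  assumes "C1_periodic \<phi>" "integral {0..1} \<phi> = 0"
    and "\<And>x. \<bar>\<phi> x - L \<phi> x\<bar> \<le> b" "\<And>x. \<bar>deriv \<phi> x - L' \<phi> x\<bar> \<le> b"
  shows "\<bar>\<phi> x\<bar> \<le> K / c * b" "\<bar>deriv \<phi> x\<bar> \<le> K / c * b"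
proof -
  define \<psi> where "\<psi> = (\<lambda>x. \<phi> x - L \<phi> x)"
  note LC = L_C1_periodic[OF assms(1)]
  have b0: "0 \<le> b"
    using assms(3)[of 0] by linarith
  have \<psi>: "C1_periodic \<psi>" and \<psi>': "deriv \<psi> x = deriv \<phi> x - L' \<phi> x" for x
    using C1_periodic_diff[OF assms(1) LC] by (auto simp: \<psi>_def deriv_L[OF assms(1)])
  have "integral {0..1} \<psi> = 0"
    unfolding \<psi>_def
    using C1_periodic_imp_continuous[OF LC, of "{0..1}"] C1_periodic_imp_continuous[OF assms(1)]
      L_integral[of \<phi>] C1_periodic_imp_periodic[OF assms(1)]
    by (subst integral_diff) (auto intro: integrable_continuous_real)
  note dec = L_power_decay[OF \<psi> this, of b, unfolded \<psi>', OF assms(3)[folded fun_cong[OF \<psi>_def]] assms(4)]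
  have dec1: "\<bar>(L ^^ k) \<psi> x\<bar> \<le> K * b * (1 - c) ^ k"
    and dec2: "\<bar>deriv ((L ^^ k) \<psi>) x\<bar> \<le> K * b * (1 - c) ^ k" for k x
    using dec by blast+
  have pw: "(L ^^ k) \<psi> x = (L ^^ k) \<phi> x - (L ^^ Suc k) \<phi> x" for k x
  proof -
    have "(L ^^ k) \<psi> = (\<lambda>x. (L ^^ k) \<phi> x - (L ^^ Suc k) \<phi> x)"
      by (induction k) (simp_all add: \<psi>_def L_diff)
    then show ?thesis by simp
  qed
  have tele: "\<phi> x - (L ^^ n) \<phi> x = (\<Sum>k<n. (L ^^ k) \<psi> x)" for n x
    using sum_lessThan_telescope'[of "\<lambda>k. (L ^^ k) \<phi> x" n] by (simp add: pw)
  \<comment> \<open>Both sides are derivatives of the same function, by the finite identity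
    \<open>tele\<close>.\<close>
  have tele': "deriv \<phi> x - deriv ((L ^^ n) \<phi>) x = (\<Sum>k<n. deriv ((L ^^ k) \<psi>) x)" for n x
  proof (rule DERIV_unique)
    show "((\<lambda>x. \<phi> x - (L ^^ n) \<phi> x) has_real_derivative deriv \<phi> x - deriv ((L ^^ n) \<phi>) x) (at x)"
      by (intro derivative_intros C1_periodic_DERIV assms L_power_integral)
    show "((\<lambda>x. \<phi> x - (L ^^ n) \<phi> x) has_real_derivative (\<Sum>k<n. deriv ((L ^^ k) \<psi>) x)) (at x)"
      unfolding tele by (intro derivative_intros C1_periodic_DERIV \<psi> L_power_integral)
  qed
  have geo: "(\<Sum>k<n. K * b * (1 - c) ^ k) \<le> K / c * b" for n
  proof -
    have "(\<Sum>k<n. K * b * (1 - c) ^ k) \<le> (\<Sum>k. K * b * (1 - c) ^ k)"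
      using K_nonneg b0 c_bounds by (intro sum_le_suminf summable_mult summable_geometric) auto
    also have "\<dots> = K / c * b"
      using c_bounds by (subst suminf_mult) (auto intro: summable_geometric simp: suminf_geometric)
    finally show ?thesis .
  qed
  \<comment> \<open>This bound on \<open>\<phi>\<close> itself controls only the remainder and drops
    out as \<open>n\<close> tends to infinity.\<close>
  obtain B where B: "0 \<le> B" "\<And>x. \<bar>\<phi> x\<bar> \<le> B" "\<And>x. \<bar>deriv \<phi> x\<bar> \<le> B"
    using C1_periodic_bounded[OF assms(1)] by blast
  note decB = L_power_decay[OF assms(1,2) B(2,3)]
  have lim: "(\<lambda>n. K / c * b + K * B * (1 - c) ^ n) \<longlonglongrightarrow> K / c * b + K * B * 0"
    using c_bounds by (intro tendsto_intros LIMSEQ_realpow_zero) auto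
  have "\<bar>\<phi> x\<bar> \<le> K / c * b + K * B * (1 - c) ^ n" for n
  proof -
    have "\<bar>\<phi> x - (L ^^ n) \<phi> x\<bar> \<le> K / c * b"
      unfolding tele by (rule order_trans[OF sum_abs order_trans[OF sum_mono[OF dec1] geo]])
    then show ?thesis
      using decB(2)[of n x] by linarith
  qed
  then show "\<bar>\<phi> x\<bar> \<le> K / c * b"
    using LIMSEQ_le_const[OF lim] by fastforce
  have "\<bar>deriv \<phi> x\<bar> \<le> K / c * b + K * B * (1 - c) ^ n" for n
  proof -
    have "\<bar>deriv \<phi> x - deriv ((L ^^ n) \<phi>) x\<bar> \<le> K / c * b"
      unfolding tele' by (rule order_trans[OF sum_abs order_trans[OF sum_mono[OF dec2] geo]])
    then show ?thesis
      using decB(3)[of n x] by linarith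
  qed
  then show "\<bar>deriv \<phi> x\<bar> \<le> K / c * b"
    using LIMSEQ_le_const[OF lim] by fastforce
qed

text \<open>The solution is the Neumann series. The decay estimate dominates both the series and its
  termwise derivatives, so the sum is \<open>C^1\<close>; uniform convergence keeps the mean
  zero.\<close>

lemma resolvent_exists:
  assumes "C1_periodic \<psi>" "integral {0..1} \<psi> = 0"
  obtains \<phi> where "C1_periodic \<phi>" "integral {0..1} \<phi> = 0" "\<And>x. \<phi> x - L \<phi> x = \<psi> x"
proof -
  obtain B where B: "0 \<le> B" "\<And>x. \<bar>\<psi> x\<bar> \<le> B" "\<And>x. \<bar>deriv \<psi> x\<bar> \<le> B"
    using C1_periodic_bounded[OF assms(1)] by blast
  note dec = L_power_decay[OF assms B(2,3)]
  define F where "F n = (L ^^ n) \<psi>" for n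
  define \<phi> where "\<phi> x = (\<Sum>n. F n x)" for x
  have F: "C1_periodic (F n)" "\<bar>F n x\<bar> \<le> K * B * (1 - c) ^ n" "\<bar>deriv (F n) x\<bar> \<le> K * B * (1 - c) ^ n" for n x
    using dec by (auto simp: F_def)
  have sm: "summable (\<lambda>n. K * B * (1 - c) ^ n)"
    using c_bounds by (intro summable_mult summable_geometric) auto
  have u: "uniform_limit UNIV (\<lambda>n x. \<Sum>i<n. F i x) \<phi> sequentially"
    unfolding \<phi>_def using F by (intro Weierstrass_m_test[OF _ sm]) auto
  have u': "uniform_limit UNIV (\<lambda>n x. \<Sum>i<n. deriv (F i) x) (\<lambda>x. \<Sum>i. deriv (F i) x) sequentially"
    using F by (intro Weierstrass_m_test[OF _ sm]) auto
  have s: "summable (\<lambda>n. F n x)" for x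
    using F by (intro summable_comparison_test'[OF sm, of 0]) auto
  have D: "(\<phi> has_real_derivative (\<Sum>i. deriv (F i) x)) (at x)" for x
    unfolding \<phi>_def[abs_def]
  proof (rule has_field_derivative_series'(2)[where S=UNIV and ?x0.0=0])
    show "uniformly_convergent_on UNIV (\<lambda>n x. \<Sum>i<n. deriv (F i) x)"
      using u' by (auto simp: uniformly_convergent_on_def)
  qed (use s F(1) in \<open>auto intro: C1_periodic_DERIV\<close>)
  have "continuous_on UNIV (\<lambda>x. \<Sum>i. deriv (F i) x)"
    using F(1) by (intro uniform_limit_theorem[OF _ u'] always_eventually allI continuous_intros
        C1_periodic_continuous_deriv) auto
  moreover have "periodic1 \<phi>"
    using F(1) by (auto simp: \<phi>_def C1_periodic_def periodic1_def)
  ultimately have C: "C1_periodic \<phi>"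
    using C1_periodicI[OF _ D] by blast
  have "integral {0..1} \<phi> = 0"
  proof -
    have "uniform_limit {0..1} (\<lambda>n x. \<Sum>i<n. F i x) \<phi> sequentially"
      by (rule uniform_limit_on_subset[OF u]) auto
    moreover have "continuous_on {0..1} (\<lambda>x. \<Sum>i<n. F i x)" for n
      by (intro continuous_intros C1_periodic_imp_continuous F)
    ultimately obtain I J where IJ: "\<And>n. ((\<lambda>x. \<Sum>i<n. F i x) has_integral I n) {0..1}"
      "(\<phi> has_integral J) {0..1}" "I \<longlonglongrightarrow> J"
      by (rule uniform_limit_integral) auto
    have "integral {0..1} (F i) = 0" for i
      using L_power_integral(2)[OF assms(1)] assms(2) by (simp add: F_def)
    then have "(F i has_integral 0) {0..1}" for i
      using C1_periodic_imp_continuous[OF F(1), of "{0..1}" i]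
      by (metis integrable_continuous_real integrable_integral)
    then have "((\<lambda>x. \<Sum>i<n. F i x) has_integral (\<Sum>i<n. 0)) {0..1}" for n
      by (intro has_integral_sum) auto
    from has_integral_unique[OF IJ(1) this] have "I = (\<lambda>n. 0)"
      by auto
    with IJ(3) have "J = 0"
      by (simp add: LIMSEQ_const_iff)
    then show ?thesis
      using IJ(2) by (simp add: integral_unique)
  qed
  moreover have "\<phi> x - L \<phi> x = \<psi> x" for x
  proof -
    \<comment> \<open>\<open>L\<close> evaluates its argument at finitely many points, so it passes
      through a pointwise convergent series.\<close>
    have "(\<lambda>n. L (F n) x) sums L \<phi> x"
      unfolding L_def \<phi>_def by (intro sums_sum sums_mult2 summable_sums s)
    then have "(\<lambda>n. F (Suc n) x) sums L \<phi> x"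
      by (simp add: F_def)
    then have "(\<lambda>n. F n x) sums (L \<phi> x + F 0 x)"
      by (rule sums_Suc)
    then show ?thesis
      using summable_sums[OF s[of x]] sums_unique2 by (fastforce simp: \<phi>_def F_def)
  qed
  ultimately show ?thesis
    using that C by blast
qed

end

section \<open>The transfer operator of an expanding lift\<close>

locale expanding_lift =
  fixes F F1 F2 :: "real \<Rightarrow> real" and \<sigma> lam B :: real and N :: nat
  assumes F_DERIV: "(F has_real_derivative F1 x) (at x)"
    and F1_DERIV: "(F1 has_real_derivative F2 x) (at x)"
    and F2_continuous: "continuous_on UNIV F2"
    and F_shift: "F (x + 1) = F x + \<sigma> * real N"
    and sign: "\<sigma> = 1 \<or> \<sigma> = - 1"
    and lam: "1 < lam"
    and expanding: "lam \<le> \<sigma> * F1 x"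
    and F2_bound: "\<bar>F2 x\<bar> \<le> B"
begin

section \<open>The inverse of an expanding lift\<close>

lemma F_shift_int: "F (x + of_int n) = F x + of_int n * \<sigma> * real N"
proof -
  \<comment> \<open>Subtracting the linear function of slope \<open>\<sigma> * N\<close> leaves a
    periodic function.\<close>
  have "periodic1 (\<lambda>x. F x - x * \<sigma> * real N)"
    unfolding periodic1_def F_shift by (simp add: distrib_right)
  from periodic1_add_int[OF this, of x n] show ?thesis
    by (simp add: algebra_simps)
qed

lemma F_growth: "x \<le> y \<Longrightarrow> lam * (y - x) \<le> \<sigma> * (F y - F x)"
proof (cases "x = y")
  case False
  assume "x \<le> y"
  with False have "x < y" by simp
  from MVT2[OF this, of F F1] F_DERIV obtain z where z: "F y - F x = (y - x) * F1 z"
    by blast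
  show ?thesis
    using mult_left_mono[OF expanding[of z], of "y - x"] \<open>x < y\<close> by (simp add: z algebra_simps)
qed simp

lemma F_expands: "lam * \<bar>y - x\<bar> \<le> \<bar>F y - F x\<bar>"
proof -
  have s: "\<bar>\<sigma> * (F y - F x)\<bar> = \<bar>F y - F x\<bar>"
    using sign by auto
  have "lam * \<bar>y - x\<bar> \<le> \<bar>\<sigma> * (F y - F x)\<bar>"
  proof (cases "x \<le> y")
    case True
    then show ?thesis using F_growth[OF True] by simp
  next
    case False
    then show ?thesis using F_growth[of y x] by (simp add: algebra_simps abs_le_iff abs_if)
  qed
  then show ?thesis by (simp add: s)
qed

lemma inj_F: "inj F"
proof (rule injI)
  fix x y assume "F x = F y"
  then have "lam * \<bar>y - x\<bar> \<le> 0"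
    using F_expands[of y x] by simp
  then show "x = y"
    using lam by (simp add: mult_le_0_iff)
qed

lemma surj_F: "surj F"
proof -
  have "\<exists>y. F y = x" for x
  proof -
    \<comment> \<open>Since \<open>\<sigma> * F\<close> grows at rate at least
      \<open>lam > 1\<close>, moving by \<open>r\<close> from \<open>0\<close> changes it by at
      least \<open>r\<close>, enough to pass \<open>\<sigma> * x\<close> in either
      direction.\<close>
    define r where "r = \<bar>\<sigma> * x - \<sigma> * F 0\<bar>"
    have r: "r \<le> lam * r" "0 \<le> r"
      using lam by (auto simp: r_def mult_le_cancel_right1)
    have "\<sigma> * F (- r) \<le> \<sigma> * x" "\<sigma> * x \<le> \<sigma> * F r"
      using F_growth[of 0 r] F_growth[of "-r" 0] r by (auto simp: r_def algebra_simps)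
    moreover have "continuous_on {-r..r} (\<lambda>y. \<sigma> * F y)"
      using F_DERIV by (intro continuous_intros) (meson DERIV_isCont continuous_at_imp_continuous_on)
    ultimately obtain y where "\<sigma> * F y = \<sigma> * x"
      using IVT'[of "\<lambda>y. \<sigma> * F y" "-r" "\<sigma> * x" r] r by auto
    then show ?thesis
      using sign by auto
  qed
  then show ?thesis by (metis surjI)
qed

definition g :: "real \<Rightarrow> real" where "g = inv F"

lemma F_g [simp]: "F (g x) = x"
  using surj_F by (simp add: g_def surj_f_inv_f)

lemma g_F [simp]: "g (F x) = x"
  using inj_F by (simp add: g_def)

lemma g_unique: "F y = x \<Longrightarrow> g x = y"
  by auto

lemma g_lipschitz: "\<bar>g x - g y\<bar> \<le> \<bar>x - y\<bar>"
proof -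
  have "\<bar>g x - g y\<bar> \<le> lam * \<bar>g x - g y\<bar>"
    using lam by (simp add: mult_le_cancel_right1)
  also have "\<dots> \<le> \<bar>x - y\<bar>"
    using F_expands[of "g x" "g y"] by simp
  finally show ?thesis .
qed

lemma isCont_g: "isCont g x"
proof -
  have "(g \<longlongrightarrow> g x) (at x)"
  proof (rule Lim_null_comparison[where g="\<lambda>y. \<bar>y - x\<bar>", THEN Lim_null[THEN iffD2]])
    show "\<forall>\<^sub>F y in at x. norm (g y - g x) \<le> \<bar>y - x\<bar>"
      using g_lipschitz by simp
    show "((\<lambda>y. \<bar>y - x\<bar>) \<longlongrightarrow> 0) (at x)"
      by (auto intro!: tendsto_eq_intros)
  qed
  then show ?thesis by (simp add: isCont_def)
qed

lemma F1_nonzero: "F1 x \<noteq> 0"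
  using expanding[of x] lam by auto

lemma g_DERIV: "(g has_real_derivative 1 / F1 (g x)) (at x)"
  using DERIV_inverse_function[OF F_DERIV F1_nonzero _ _ _ isCont_g, of "x - 1" x "x + 1"]
  by (simp add: inverse_eq_divide)

definition g1 :: "real \<Rightarrow> real" where "g1 x = 1 / F1 (g x)"
definition g2 :: "real \<Rightarrow> real" where "g2 x = - F2 (g x) / F1 (g x) ^ 3"

lemma sign_g1: "\<sigma> * g1 x = 1 / (\<sigma> * F1 (g x))" "\<bar>F1 x\<bar> = \<sigma> * F1 x"
  using sign expanding[of x] lam by (auto simp: g1_def)

text \<open>From \<open>g1 = 1 / F1\<close> and \<open>g2 = - F2 / F1 ^ 3\<close> at the preimage,
  the ratio of \<open>g2\<close> to \<open>g1\<close> is \<open>F2 / F1 ^ 2\<close> in absolute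
  value. Hence the distortion constant is \<open>B / lam ^ 2\<close>, and no other data of
  \<open>F\<close> enter the constants.\<close>

sublocale expanding_branches g g1 g2 \<sigma> "1 / lam" "B / lam\<^sup>2" N
proof
  fix x
  show "(g has_real_derivative g1 x) (at x)"
    unfolding g1_def by (rule g_DERIV)
  show "(g1 has_real_derivative g2 x) (at x)"
    unfolding g1_def[abs_def] g2_def using F1_nonzero
    by (auto intro!: derivative_eq_intros DERIV_chain2[OF F1_DERIV] g_DERIV
        simp: field_simps power2_eq_square power3_eq_cube)
  have cF1: "continuous_on UNIV F1"
    using F1_DERIV by (meson DERIV_isCont continuous_at_imp_continuous_on)
  have "continuous_on UNIV g"
    using isCont_g by (simp add: continuous_at_imp_continuous_on)
  then show "continuous_on UNIV g2"
    unfolding g2_def using F1_nonzero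
    by (intro continuous_intros continuous_on_compose2[OF cF1] continuous_on_compose2[OF F2_continuous]) auto
  have "F (g x + \<sigma>) = x + real N"
    using F_shift_int[of "g x" 1] F_shift_int[of "g x" "-1"] sign by auto
  then show "g (x + real N) = g x + \<sigma>"
    by (rule g_unique)
  show "0 < \<sigma> * g1 x" "\<sigma> * g1 x \<le> 1 / lam"
    unfolding sign_g1 using expanding[of "g x"] lam by (auto simp: frac_le)
  have "\<bar>g2 x\<bar> = \<bar>F2 (g x)\<bar> / \<bar>F1 (g x)\<bar>\<^sup>2 * (\<sigma> * g1 x)"
    unfolding sign_g1(1) sign_g1(2)[symmetric] using F1_nonzero
    by (simp add: g2_def power2_eq_square power3_eq_cube abs_mult abs_divide)
  also have "\<dots> \<le> B / lam\<^sup>2 * (\<sigma> * g1 x)"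
  proof (intro mult_right_mono frac_le F2_bound power_mono)
    show "lam \<le> \<bar>F1 (g x)\<bar>"
      unfolding sign_g1 by (rule expanding)
    show "0 \<le> \<sigma> * g1 x"
      using \<open>0 < \<sigma> * g1 x\<close> by simp
  qed (use lam F2_bound[of 0] in auto)
  finally show "\<bar>g2 x\<bar> \<le> B / lam\<^sup>2 * (\<sigma> * g1 x)" .
qed (use sign lam in auto)

lemma N_pos: "0 < N"
  using F_growth[of 0 1] F_shift[of 0] lam sign by (auto intro!: Nat.gr0I)

text \<open>The preimages of \<open>x\<close> on the circle are the fractional parts of
  \<open>g (x + k)\<close> for \<open>k < N\<close>, each occurring once. Taking fractional parts
  does not affect the summands, because \<open>\<phi>\<close> and \<open>F1\<close> are
  periodic.\<close>

lemma transfer_eq_L: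
  assumes "periodic1 \<phi>" shows "transfer F \<phi> = L \<phi>"
proof
  fix x
  let ?S = "{y \<in> {0..<1}. F y - x \<in> \<int>}"
  have dF: "deriv F = F1"
    using F_DERIV by (auto simp: DERIV_imp_deriv)
  have F1p: "periodic1 F1"
    by (rule periodic1_deriv[OF _ F_DERIV])
       (use F_shift sign in \<open>auto simp: is_lift_def intro!: exI[of _ "if \<sigma> = 1 then int N else - int N"]\<close>)
  have frac_F: "F (frac y) = F y - of_int \<lfloor>y\<rfloor> * \<sigma> * real N" for y
    using F_shift_int[of y "- \<lfloor>y\<rfloor>"] by (simp add: frac_def)
  obtain s :: int where s: "\<sigma> = of_int s" "s * s = 1" "\<bar>s\<bar> = 1"
    using sign by (metis abs_1 abs_minus_cancel minus_mult_minus mult_1 of_int_1 of_int_minus)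
  have bij: "bij_betw (\<lambda>k. frac (g (x + real k))) {..<N} ?S"
    unfolding bij_betw_def
  proof (intro conjI inj_onI set_eqI iffI)
    fix k l assume kl: "k \<in> {..<N}" "l \<in> {..<N}" "frac (g (x + real k)) = frac (g (x + real l))"
    define m where "m = \<lfloor>g (x + real k)\<rfloor> - \<lfloor>g (x + real l)\<rfloor>"
    have "g (x + real k) = g (x + real l) + of_int m"
      using kl(3) by (simp add: frac_def m_def)
    then have "x + real k = F (g (x + real l) + of_int m)"
      by (metis F_g)
    also have "\<dots> = x + real l + of_int m * \<sigma> * real N"
      by (simp add: F_shift_int)
    finally have "real_of_int (int k - int l) = real_of_int (m * s * int N)"
      by (simp add: s)
    then have e: "int k - int l = m * s * int N"
      by (simp only: of_int_eq_iff)
    \<comment> \<open>The indices differ by a multiple of \<open>N\<close> and by less than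
      \<open>N\<close>, which forces \<open>m = 0\<close>.\<close>
    have "\<bar>int k - int l\<bar> < int N"
      using kl by auto
    then have "\<bar>m\<bar> * int N < 1 * int N"
      unfolding e by (simp add: abs_mult s)
    then have "\<bar>m\<bar> < 1"
      using mult_less_cancel_right_pos N_pos by (metis of_nat_0_less_iff)
    then show "k = l"
      using e by simp
  next
    fix y assume "y \<in> (\<lambda>k. frac (g (x + real k))) ` {..<N}"
    then obtain k where k: "y = frac (g (x + real k))" by blast
    have "F y - x = of_int (int k - \<lfloor>g (x + real k)\<rfloor> * s * int N)"
      by (simp add: k frac_F s)
    then have "F y - x \<in> \<int>"
      by (metis Ints_of_int)
    then show "y \<in> ?S"
      by (simp add: k frac_lt_1)
  next
    fix y assume y: "y \<in> ?S"
    then obtain j where j: "F y - x = of_int j"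
      by (auto elim: Ints_cases)
    define i where "i = j div int N"
    define k where "k = nat (j mod int N)"
    have k: "k < N" "int k = j mod int N"
      using N_pos by (auto simp: k_def nat_less_iff)
    have "j = int k + int N * i"
      by (simp add: k i_def)
    then have rj: "real_of_int j = real k + real N * of_int i"
      by simp
    \<comment> \<open>Translating \<open>y\<close> by \<open>- (s * i)\<close> changes
      \<open>F y\<close> by \<open>- N * i\<close>, because \<open>s * s = 1\<close>; what is left
      of \<open>j\<close> is its remainder \<open>k\<close>.\<close>
    have "F (y + of_int (- (s * i))) = x + real k + real N * of_int i - of_int (s * s) * real N * of_int i"
      using j rj unfolding F_shift_int by (simp add: s(1))
    then have "F (y + of_int (- (s * i))) = x + real k"
      by (simp only: s(2))
    then have "g (x + real k) = y + of_int (- (s * i))"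
      by (rule g_unique)
    moreover have "frac (y + of_int (- (s * i))) = frac y"
      by (rule periodic1_add_int) (simp add: periodic1_def frac_1_eq)
    ultimately have "frac (g (x + real k)) = frac y"
      by simp
    then have "y = frac (g (x + real k))"
      using y by (simp add: frac_eq)
    then show "y \<in> (\<lambda>k. frac (g (x + real k))) ` {..<N}"
      using k by auto
  qed
  have "transfer F \<phi> x = (\<Sum>k<N. \<phi> (frac (g (x + real k))) / \<bar>F1 (frac (g (x + real k)))\<bar>)"
    unfolding transfer_def dF by (rule sum.reindex_bij_betw[OF bij, symmetric])
  also have "\<dots> = L \<phi> x"
    unfolding L_def sign_g1 by (simp add: periodic1_frac[OF assms] periodic1_frac[OF F1p] sign_g1(2))
  finally show "transfer F \<phi> x = L \<phi> x" .
qed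

text \<open>The change of variables underlying duality is \<open>L_integral\<close> applied to \<open>\<phi> \<circ> F * \<rho>\<close>.\<close>

lemma invariant_density_fixed:
  assumes "continuous_on UNIV \<rho>" "periodic1 \<rho>"
    and inv: "\<And>\<phi>. continuous_on UNIV \<phi> \<Longrightarrow> periodic1 \<phi> \<Longrightarrow>
      integral {0..1} (\<lambda>x. \<phi> (F x) * \<rho> x) = integral {0..1} (\<lambda>x. \<phi> x * \<rho> x)"
  shows "L \<rho> = \<rho>"
proof
  \<comment> \<open>The defect itself serves as test function: duality then says that its square has
    integral zero.\<close>
  define \<phi> where "\<phi> = (\<lambda>x. L \<rho> x - \<rho> x)"
  have c: "continuous_on UNIV (L \<rho>)"
    by (rule L_continuous[OF assms(1)])
  have \<phi>: "continuous_on UNIV \<phi>" "periodic1 \<phi>"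
    using c L_periodic[OF assms(2)] assms by (auto simp: \<phi>_def periodic1_def intro!: continuous_intros)
  have cF: "continuous_on UNIV F"
    using F_DERIV by (meson DERIV_isCont continuous_at_imp_continuous_on)
  have per: "\<phi> (y + \<sigma> * real N) = \<phi> y" for y
    using periodic1_add_int[OF \<phi>(2), of y "if \<sigma> = 1 then int N else - int N"] sign by auto
  have "L (\<lambda>x. \<phi> (F x) * \<rho> x) = (\<lambda>x. \<phi> x * L \<rho> x)"
    by (auto simp: L_def periodic1_add_nat[OF \<phi>(2)] sum_distrib_left algebra_simps)
  moreover have "continuous_on UNIV (\<lambda>x. \<phi> (F x) * \<rho> x)"
    by (intro continuous_intros continuous_on_compose2[OF \<phi>(1) cF] assms) auto
  moreover have "periodic1 (\<lambda>x. \<phi> (F x) * \<rho> x)"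
    using assms(2) by (auto simp: periodic1_def F_shift per)
  ultimately have "integral {0..1} (\<lambda>x. \<phi> x * L \<rho> x) = integral {0..1} (\<lambda>x. \<phi> x * \<rho> x)"
    using L_integral inv[OF \<phi>] by metis
  moreover have "(\<lambda>x. \<phi> x * L \<rho> x) integrable_on {0..1}" "(\<lambda>x. \<phi> x * \<rho> x) integrable_on {0..1}"
    by (auto intro!: integrable_continuous_real continuous_on_mult
        intro: continuous_on_subset[OF \<phi>(1)] continuous_on_subset[OF c] continuous_on_subset[OF assms(1)])
  ultimately have "integral {0..1} (\<lambda>x. \<phi> x * L \<rho> x - \<phi> x * \<rho> x) = 0"
    by (simp add: integral_diff)
  moreover have "(\<lambda>x. \<phi> x * L \<rho> x - \<phi> x * \<rho> x) = (\<lambda>x. \<phi> x * \<phi> x)"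
    by (simp add: \<phi>_def algebra_simps)
  moreover have "continuous_on {0..1} (\<lambda>x. \<phi> x * \<phi> x)"
    by (intro continuous_intros continuous_on_subset[OF \<phi>(1)]) auto
  ultimately have z: "\<phi> x = 0" if "x \<in> {0..1}" for x
    using integral_eq_0_iff[of 0 1 "\<lambda>x. \<phi> x * \<phi> x"] that by auto
  have "\<phi> x = 0" for x
    by (rule periodic1_ball[OF \<phi>(2), where P="\<lambda>y. y = 0"]) (rule z)
  then show "L \<rho> x = \<rho> x" for x
    by (simp add: \<phi>_def)
qed

text \<open>The definite description is legitimate because the Neumann series gives a solution and
  the resolvent bound with right-hand side \<open>0\<close> makes it unique.\<close>

lemma zero_mean_inverse_transfer:
  assumes "C1_periodic \<psi>" "integral {0..1} \<psi> = 0"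
  defines "\<phi> \<equiv> zero_mean_inverse (transfer F) \<psi>"
  shows "C1_periodic \<phi>" "integral {0..1} \<phi> = 0" "\<And>x. \<phi> x - L \<phi> x = \<psi> x"
proof -
  let ?P = "\<lambda>\<phi>. C_k 1 \<phi> \<and> periodic1 \<phi> \<and> integral {0..1} \<phi> = 0 \<and> (\<forall>x. \<phi> x - transfer F \<phi> x = \<psi> x)"
  have P: "?P \<phi> \<longleftrightarrow> C1_periodic \<phi> \<and> integral {0..1} \<phi> = 0 \<and> (\<forall>x. \<phi> x - L \<phi> x = \<psi> x)" for \<phi>
    using transfer_eq_L[of \<phi>] by (auto simp: C1_periodic_def)
  have "\<exists>!\<phi>. ?P \<phi>"
    unfolding P
  proof (rule ex_ex1I)
    show "\<exists>\<phi>. C1_periodic \<phi> \<and> integral {0..1} \<phi> = 0 \<and> (\<forall>x. \<phi> x - L \<phi> x = \<psi> x)"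
      by (rule resolvent_exists[OF assms(1,2)]) blast
  next
    fix u v
    assume u: "C1_periodic u \<and> integral {0..1} u = 0 \<and> (\<forall>x. u x - L u x = \<psi> x)"
      and v: "C1_periodic v \<and> integral {0..1} v = 0 \<and> (\<forall>x. v x - L v x = \<psi> x)"
    let ?w = "\<lambda>x. u x - v x"
    have w: "C1_periodic ?w"
      using u v by (auto intro: C1_periodic_diff(1))
    have "integral {0..1} ?w = 0"
      using u v by (subst integral_diff)
        (auto intro!: integrable_continuous_real C1_periodic_imp_continuous)
    moreover have Lw: "L ?w = ?w"
    proof
      fix x
      have "u x - L u x = v x - L v x"
        using u v by simp
      then show "L ?w x = ?w x"
        unfolding L_diff by linarith
    qed
    moreover have "L' ?w = deriv ?w"
      using deriv_L[OF w] by (simp only: Lw)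
    ultimately have "\<bar>?w x\<bar> \<le> K / c * 0" for x
      by (intro resolvent_bound[OF w]) simp_all
    then show "u = v"
      by auto
  qed
  from theI'[OF this] have "?P \<phi>"
    unfolding \<phi>_def zero_mean_inverse_def .
  then show "C1_periodic \<phi>" "integral {0..1} \<phi> = 0" "\<And>x. \<phi> x - L \<phi> x = \<psi> x"
    unfolding P by auto
qed

end

text \<open>A continuous derivative without zeros has constant sign, and the mean value theorem over
  one period gives the degree that sign.\<close>

lemma expanding_lift_exists_sign:
  assumes "is_lift F" "\<And>x. (F has_real_derivative F1 x) (at x)" "continuous_on UNIV F1"
    "\<And>x. lam \<le> \<bar>F1 x\<bar>" "1 < lam"
  obtains \<sigma> N where "\<sigma> = 1 \<or> \<sigma> = (- 1::real)" "0 < N" "\<And>x. F (x + 1) = F x + \<sigma> * real N" "\<And>x. lam \<le> \<sigma> * F1 x"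
proof -
  obtain d :: int where d: "\<And>x. F (x + 1) = F x + of_int d"
    using assms(1) by (auto simp: is_lift_def)
  define \<sigma> where "\<sigma> = sgn (F1 0)"
  have nz: "F1 x \<noteq> 0" for x
    using assms(4)[of x] assms(5) by auto
  have sg: "sgn (F1 x) = \<sigma>" for x
  proof (rule ccontr)
    assume "sgn (F1 x) \<noteq> \<sigma>"
    then have "F1 0 < 0 \<and> 0 < F1 x \<or> F1 x < 0 \<and> 0 < F1 0"
      using nz[of x] nz[of 0] by (auto simp: \<sigma>_def sgn_if split: if_splits)
    moreover have "connected (range F1)"
      by (intro connected_continuous_image assms connected_UNIV)
    ultimately have "0 \<in> range F1"
      unfolding connected_iff_interval by (meson less_imp_le rangeI)
    then show False
      using nz by auto
  qed
  have s: "\<sigma> = 1 \<or> \<sigma> = - 1"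
    using nz[of 0] by (auto simp: \<sigma>_def sgn_if)
  have l: "lam \<le> \<sigma> * F1 x" for x
    using assms(4)[of x] abs_sgn[of "F1 x"] by (simp add: sg mult.commute)
  obtain z where "F 1 - F 0 = (1 - 0) * F1 z"
    using MVT2[of 0 1 F F1] assms(2) by auto
  then have "0 < \<sigma> * of_int d"
    using l[of z] assms(5) d[of 0] by simp
  then have "\<sigma> * real (nat \<bar>d\<bar>) = of_int d" "0 < nat \<bar>d\<bar>"
    using s by auto
  then show ?thesis
    using that[of \<sigma> "nat \<bar>d\<bar>"] s l d by auto
qed

section \<open>Continuously differentiable functions on a strip\<close>

text \<open>\<open>As\<close> and \<open>Ax\<close> are the partial derivatives in the parameter and
  in space. They are explicit arguments so that the closure rules compute them and a derivative can
  in turn be the function of another such statement.\<close>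

definition C1_on_strip ::
  "real set \<Rightarrow> (real \<Rightarrow> real \<Rightarrow> real) \<Rightarrow> (real \<Rightarrow> real \<Rightarrow> real) \<Rightarrow> (real \<Rightarrow> real \<Rightarrow> real) \<Rightarrow> bool" where
  "C1_on_strip I A As Ax \<longleftrightarrow>
     continuous_on (I \<times> UNIV) (\<lambda>(s, x). As s x) \<and> continuous_on (I \<times> UNIV) (\<lambda>(s, x). Ax s x) \<and>
     (\<forall>s\<in>I. \<forall>x. ((\<lambda>s. A s x) has_real_derivative As s x) (at s) \<and>
                 (A s has_real_derivative Ax s x) (at x))"

lemma continuous_on_strip_compose:
  assumes "continuous_on (I \<times> UNIV) (\<lambda>(s, x). A s x)" "continuous_on (I \<times> UNIV) (\<lambda>(s, x). B s x)"
  shows "continuous_on (I \<times> UNIV) (\<lambda>(s, x). A s (B s x :: real))"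
proof -
  have "continuous_on (I \<times> UNIV) (\<lambda>p. (fst p, B (fst p) (snd p)))"
    using assms(2) by (auto intro!: continuous_intros simp: case_prod_beta)
  from continuous_on_compose2[OF assms(1) this] show ?thesis
    by (force simp: case_prod_beta)
qed

text \<open>Jointly continuous partial derivatives give a total derivative;
  \<open>blinfun_mult_right\<close> presents the spatial one as a bounded linear map, in which form
  its continuity is required.\<close>

lemma C1_on_strip_has_derivative:
  assumes "C1_on_strip I A As Ax" "open I" "s \<in> I"
  shows "((\<lambda>(s, x). A s x) has_derivative (\<lambda>(u, v). As s x * u + Ax s x * v)) (at (s, x))"
proof -
  have "((\<lambda>(s, x). A s x) has_derivative (\<lambda>(u, v). As s x * u + blinfun_apply (blinfun_mult_right (Ax s x)) v))
     (at (s, x) within I \<times> UNIV)"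
  proof (rule has_derivative_partialsI[where fy="\<lambda>s x. blinfun_mult_right (Ax s x)"])
    show "((\<lambda>s. A s x) has_derivative (*) (As s x)) (at s within I)"
      using assms by (auto simp: C1_on_strip_def has_field_derivative_def intro: has_derivative_at_withinI)
    show "(A s has_derivative blinfun_apply (blinfun_mult_right (Ax s x))) (at x within UNIV)" if "s \<in> I" for s x
      using assms that by (auto simp: C1_on_strip_def has_field_derivative_def)
    have "continuous_on (I \<times> UNIV) (\<lambda>p. blinfun_mult_right ((\<lambda>(s, x). Ax s x) p))"
      using assms(1) unfolding C1_on_strip_def
      by (intro bounded_linear.continuous_on[OF bounded_linear_blinfun_mult_right]) auto
    then show "continuous (at (s, x) within I \<times> UNIV) (\<lambda>(s, x). blinfun_mult_right (Ax s x))"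
      using assms(3) unfolding continuous_on_eq_continuous_within case_prod_beta by auto
  qed auto
  moreover have "at (s, x) within I \<times> UNIV = at (s, x)"
    using assms by (intro at_within_open) (auto intro: open_Times)
  ultimately show ?thesis by simp
qed

lemma C1_on_strip_imp_continuous:
  assumes "C1_on_strip I A As Ax" "open I"
  shows "continuous_on (I \<times> UNIV) (\<lambda>(s, x). A s x)"
proof (rule continuous_at_imp_continuous_on, safe)
  fix s x :: real assume "s \<in> I"
  show "isCont (\<lambda>(s, x). A s x) (s, x)"
    by (rule has_derivative_continuous[OF C1_on_strip_has_derivative[OF assms \<open>s \<in> I\<close>]])
qed

lemma C1_on_strip_compose:
  assumes A: "C1_on_strip I A As Ax" and B: "C1_on_strip I B Bs Bx" and I: "open I"
  shows "C1_on_strip I (\<lambda>s x. A s (B s x)) (\<lambda>s x. As s (B s x) + Ax s (B s x) * Bs s x)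
           (\<lambda>s x. Ax s (B s x) * Bx s x)"
  unfolding C1_on_strip_def
proof (intro conjI ballI allI)
  note cB = C1_on_strip_imp_continuous[OF B I]
  have c: "continuous_on (I \<times> UNIV) (\<lambda>(s, x). As s (B s x))" "continuous_on (I \<times> UNIV) (\<lambda>(s, x). Ax s (B s x))"
    "continuous_on (I \<times> UNIV) (\<lambda>(s, x). Bs s x)" "continuous_on (I \<times> UNIV) (\<lambda>(s, x). Bx s x)"
    using A B cB by (auto simp: C1_on_strip_def intro: continuous_on_strip_compose)
  then show "continuous_on (I \<times> UNIV) (\<lambda>(s, x). As s (B s x) + Ax s (B s x) * Bs s x)"
    "continuous_on (I \<times> UNIV) (\<lambda>(s, x). Ax s (B s x) * Bx s x)"
    unfolding case_prod_beta by (auto intro!: continuous_intros)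
  fix s x assume s: "s \<in> I"
  have "((\<lambda>s. B s x) has_derivative (*) (Bs s x)) (at s)"
    using B s by (auto simp: C1_on_strip_def has_field_derivative_def)
  then have "((\<lambda>s. (s, B s x)) has_derivative (\<lambda>u. (u, Bs s x * u))) (at s)"
    by (auto intro!: derivative_eq_intros)
  from has_derivative_compose[OF this C1_on_strip_has_derivative[OF A I s]]
  have "((\<lambda>s. A s (B s x)) has_derivative (\<lambda>u. As s (B s x) * u + Ax s (B s x) * (Bs s x * u))) (at s)"
    by simp
  then show "((\<lambda>s. A s (B s x)) has_real_derivative As s (B s x) + Ax s (B s x) * Bs s x) (at s)"
    unfolding has_field_derivative_def
    by (rule has_derivative_eq_rhs) (auto simp: fun_eq_iff algebra_simps)
  show "((\<lambda>x. A s (B s x)) has_real_derivative Ax s (B s x) * Bx s x) (at x)"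
    using A B s by (auto simp: C1_on_strip_def intro: DERIV_chain2)
qed

lemma C1_on_strip_mult:
  assumes A: "C1_on_strip I A As Ax" and B: "C1_on_strip I B Bs Bx" and I: "open I"
  shows "C1_on_strip I (\<lambda>s x. A s x * B s x) (\<lambda>s x. As s x * B s x + A s x * Bs s x)
           (\<lambda>s x. Ax s x * B s x + A s x * Bx s x)"
  unfolding C1_on_strip_def
proof (intro conjI ballI allI)
  note c = C1_on_strip_imp_continuous[OF A I] C1_on_strip_imp_continuous[OF B I]
  then show "continuous_on (I \<times> UNIV) (\<lambda>(s, x). As s x * B s x + A s x * Bs s x)"
    "continuous_on (I \<times> UNIV) (\<lambda>(s, x). Ax s x * B s x + A s x * Bx s x)"
    using A B unfolding C1_on_strip_def case_prod_beta by (auto intro!: continuous_intros)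
qed (use A B in \<open>auto simp: C1_on_strip_def intro!: derivative_eq_intros\<close>)

lemma C1_on_strip_inverse:
  assumes A: "C1_on_strip I A As Ax" and nz: "\<And>s x. s \<in> I \<Longrightarrow> A s x \<noteq> 0" and I: "open I"
  shows "C1_on_strip I (\<lambda>s x. inverse (A s x)) (\<lambda>s x. - (inverse (A s x) * As s x * inverse (A s x)))
           (\<lambda>s x. - (inverse (A s x) * Ax s x * inverse (A s x)))"
  unfolding C1_on_strip_def
proof (intro conjI ballI allI)
  note c = C1_on_strip_imp_continuous[OF A I]
  then show "continuous_on (I \<times> UNIV) (\<lambda>(s, x). - (inverse (A s x) * As s x * inverse (A s x)))"
    "continuous_on (I \<times> UNIV) (\<lambda>(s, x). - (inverse (A s x) * Ax s x * inverse (A s x)))"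
    using A nz unfolding C1_on_strip_def case_prod_beta by (auto intro!: continuous_intros)
qed (use A nz in \<open>auto simp: C1_on_strip_def intro!: DERIV_inverse'\<close>)

lemma C1_on_strip_add:
  assumes "C1_on_strip I A As Ax" "C1_on_strip I B Bs Bx"
  shows "C1_on_strip I (\<lambda>s x. A s x + B s x) (\<lambda>s x. As s x + Bs s x) (\<lambda>s x. Ax s x + Bx s x)"
  using assms unfolding C1_on_strip_def case_prod_beta
  by (auto intro!: continuous_intros DERIV_add)

text \<open>Brings the raw output of the closure rules into a prescribed form. The expressions agree
  for parameters in \<open>I\<close> only; openness makes this enough for the parameter
  derivative.\<close>

lemma C1_on_strip_cong:
  assumes A: "C1_on_strip I A As Ax" and I: "open I"
    and eq: "\<And>s x. s \<in> I \<Longrightarrow> A' s x = A s x" "\<And>s x. s \<in> I \<Longrightarrow> As' s x = As s x"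
      "\<And>s x. s \<in> I \<Longrightarrow> Ax' s x = Ax s x"
  shows "C1_on_strip I A' As' Ax'"
  unfolding C1_on_strip_def
proof (intro conjI ballI allI)
  have "continuous_on (I \<times> UNIV) (\<lambda>(s, x). As' s x) = continuous_on (I \<times> UNIV) (\<lambda>(s, x). As s x)"
    "continuous_on (I \<times> UNIV) (\<lambda>(s, x). Ax' s x) = continuous_on (I \<times> UNIV) (\<lambda>(s, x). Ax s x)"
    by (rule continuous_on_cong; auto simp: eq)+
  then show "continuous_on (I \<times> UNIV) (\<lambda>(s, x). As' s x)" "continuous_on (I \<times> UNIV) (\<lambda>(s, x). Ax' s x)"
    using A by (simp_all add: C1_on_strip_def)
  fix s x assume s: "s \<in> I"
  have "((\<lambda>s. A s x) has_real_derivative As s x) (at s)"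
    using A s by (simp add: C1_on_strip_def)
  then show "((\<lambda>s. A' s x) has_real_derivative As' s x) (at s)"
    unfolding eq(2)[OF s] by (rule has_field_derivative_transform_within_open[OF _ I s]) (simp add: eq)
  have "A' s = A s"
    using s by (simp add: eq fun_eq_iff)
  then show "(A' s has_real_derivative Ax' s x) (at x)"
    using A s by (simp add: C1_on_strip_def eq)
qed

lemma C1_on_strip_sum:
  assumes "\<And>k. k \<in> T \<Longrightarrow> C1_on_strip I (A k) (As k) (Ax k)"
  shows "C1_on_strip I (\<lambda>s x. \<Sum>k\<in>T. A k s x) (\<lambda>s x. \<Sum>k\<in>T. As k s x) (\<lambda>s x. \<Sum>k\<in>T. Ax k s x)"
  using assms unfolding C1_on_strip_def case_prod_beta
  by (auto intro!: continuous_intros DERIV_sum)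

lemma C1_on_strip_fst_const:
  assumes "\<And>x. (\<phi> has_real_derivative \<phi>' x) (at x)" "continuous_on UNIV \<phi>'"
  shows "C1_on_strip I (\<lambda>s. \<phi>) (\<lambda>s x. 0) (\<lambda>s. \<phi>')"
  using assms unfolding C1_on_strip_def case_prod_beta
  by (auto intro!: continuous_on_compose2[OF assms(2)] continuous_intros)

lemma C1_on_strip_shift:
  assumes "C1_on_strip I A As Ax"
  shows "C1_on_strip I (\<lambda>s x. A s (x + r)) (\<lambda>s x. As s (x + r)) (\<lambda>s x. Ax s (x + r))"
  unfolding C1_on_strip_def
proof (intro conjI ballI allI)
  have "continuous_on (I \<times> UNIV) (\<lambda>(s, x). x + r)"
    unfolding case_prod_beta by (intro continuous_intros)
  then show "continuous_on (I \<times> UNIV) (\<lambda>(s, x). As s (x + r))"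
    "continuous_on (I \<times> UNIV) (\<lambda>(s, x). Ax s (x + r))"
    using assms by (auto simp: C1_on_strip_def intro: continuous_on_strip_compose)
  fix s x assume "s \<in> I"
  then show "((\<lambda>s. A s (x + r)) has_real_derivative As s (x + r)) (at s)"
    "((\<lambda>x. A s (x + r)) has_real_derivative Ax s (x + r)) (at x)"
    using assms unfolding DERIV_shift[of "A s" _ x r, symmetric] by (auto simp: C1_on_strip_def)
qed

section \<open>Uniform limits as the parameter varies\<close>

lemma strip_uniform_limit:
  assumes "continuous_on (I \<times> UNIV) (\<lambda>(s, x). A s x :: real)" "open I" "t \<in> I" "compact (C :: real set)"
  shows "uniform_limit C A (A t) (at (t :: real))"
proof (rule uniform_limitI)
  fix e :: real assume "e > 0"
  obtain X0 where X0: "t \<in> X0" "open X0" "\<forall>s\<in>X0 \<inter> I. \<forall>x\<in>C. dist (A s x) (A t x) \<le> e / 2"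
    using continuous_on_prod_compactE[OF continuous_on_subset[OF assms(1)] assms(4,3), of "e / 2"] \<open>e > 0\<close>
    by auto
  have "\<forall>\<^sub>F s in at t. s \<in> X0 \<inter> I"
    using X0 assms by (intro eventually_at_in_open') auto
  then show "\<forall>\<^sub>F s in at t. \<forall>x\<in>C. dist (A s x) (A t x) < e"
    by eventually_elim (use X0(3) \<open>e > 0\<close> in force)
qed

text \<open>By the mean value theorem in the parameter, each quotient is a value
  \<open>As r x\<close> with \<open>r\<close> between \<open>s\<close> and \<open>t\<close>, and
  \<open>As\<close> converges uniformly on compact sets.\<close>

lemma strip_uniform_difference_quotient:
  assumes "C1_on_strip I A As Ax" "open I" "t \<in> I" "compact C"
  shows "uniform_limit C (\<lambda>s x. (A s x - A t x) / (s - t)) (As t) (at t)"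
proof (rule uniform_limitI)
  fix e :: real assume "e > 0"
  have "continuous_on (I \<times> UNIV) (\<lambda>(s, x). As s x)"
    using assms(1) by (simp add: C1_on_strip_def)
  from strip_uniform_limit[OF this assms(2-4)] \<open>e > 0\<close>
  have "\<forall>\<^sub>F s in at t. \<forall>x\<in>C. dist (As s x) (As t x) < e"
    by (rule uniform_limitD)
  then have "\<forall>\<^sub>F s in at t. s \<in> I \<and> (\<forall>x\<in>C. dist (As s x) (As t x) < e)"
    using eventually_at_in_open'[OF assms(2,3)] by eventually_elim auto
  then obtain d where d: "d > 0"
    "\<And>s. s \<noteq> t \<Longrightarrow> dist s t < d \<Longrightarrow> s \<in> I \<and> (\<forall>x\<in>C. dist (As s x) (As t x) < e)"
    unfolding eventually_at by blast
  have "dist ((A s x - A t x) / (s - t)) (As t x) < e" if s: "s \<noteq> t" "dist s t < d" and x: "x \<in> C" for s x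
  proof -
    have in_I: "r \<in> I" if "\<bar>r - t\<bar> \<le> \<bar>s - t\<bar>" for r
      using d(2)[of r] that s assms(3) by (cases "r = t") (auto simp: dist_real_def)
    have D: "((\<lambda>s. A s x) has_real_derivative As r x) (at r)" if "\<bar>r - t\<bar> \<le> \<bar>s - t\<bar>" for r
      using assms(1) in_I[OF that] by (simp add: C1_on_strip_def)
    \<comment> \<open>The intermediate parameter must differ from \<open>t\<close>, since the
      estimate is available on a punctured neighbourhood.\<close>
    have "\<exists>r. r \<noteq> t \<and> \<bar>r - t\<bar> \<le> \<bar>s - t\<bar> \<and> (A s x - A t x) / (s - t) = As r x"
    proof (cases "t < s")
      case True
      then obtain z where "t < z" "z < s" "A s x - A t x = (s - t) * As z x"
        using MVT2[of t s "\<lambda>s. A s x" "\<lambda>r. As r x"] D by auto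
      then show ?thesis by (intro exI[of _ z]) auto
    next
      case False
      with s have "s < t" by simp
      then obtain z where "s < z" "z < t" "A t x - A s x = (t - s) * As z x"
        using MVT2[of s t "\<lambda>s. A s x" "\<lambda>r. As r x"] D by auto
      then show ?thesis by (intro exI[of _ z]) (auto simp: field_simps)
    qed
    then obtain r where "r \<noteq> t" "\<bar>r - t\<bar> \<le> \<bar>s - t\<bar>" "(A s x - A t x) / (s - t) = As r x"
      by blast
    then show ?thesis
      using d(2)[of r] s x by (auto simp: dist_real_def)
  qed
  then show "\<forall>\<^sub>F s in at t. \<forall>x\<in>C. dist ((A s x - A t x) / (s - t)) (As t x) < e"
    using d(1) unfolding eventually_at by blast
qed

text \<open>Interchange of partial derivatives: the difference quotients of \<open>A\<close> in the
  parameter converge to \<open>As t\<close>, their spatial derivatives converge uniformly to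
  \<open>A1s t\<close>, and so the limit may be differentiated.\<close>

lemma strip_mixed_derivative:
  assumes A: "C1_on_strip I A As A1" and A1: "C1_on_strip I A1 A1s A1x" and I: "open I" "t \<in> I"
  shows "(As t has_real_derivative A1s t x) (at x)"
proof -
  let ?S = "{x - 1..x + 1}"
  \<comment> \<open>The theorem on differentiating a limit concerns sequences, so the parameter runs
    to \<open>t\<close> along one that never meets \<open>t\<close>; it is later shifted by
    \<open>n0\<close> to stay inside \<open>I\<close>.\<close>
  define u where "u n = t + inverse (real (Suc n))" for n
  have u: "filterlim u (at t) sequentially"
    unfolding filterlim_at using LIMSEQ_inverse_real_of_nat_add[of t] by (auto simp: u_def[abs_def])
  have lim: "uniform_limit ?S (\<lambda>n x. (A (u n) x - A t x) / (u n - t)) (As t) sequentially"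
    "uniform_limit ?S (\<lambda>n x. (A1 (u n) x - A1 t x) / (u n - t)) (A1s t) sequentially"
    using filterlim_compose[OF strip_uniform_difference_quotient[OF A I compact_Icc] u]
      filterlim_compose[OF strip_uniform_difference_quotient[OF A1 I compact_Icc] u] .
  have "\<forall>\<^sub>F n in sequentially. u n \<in> I"
    using filterlim_compose[OF _ u] eventually_at_in_open'[OF I] u by (auto simp: filterlim_iff)
  then obtain n0 where n0: "\<And>n. n \<ge> n0 \<Longrightarrow> u n \<in> I"
    by (auto simp: eventually_sequentially)
  have "\<exists>G. \<forall>y\<in>?S. (\<lambda>n. (A (u (n + n0)) y - A t y) / (u (n + n0) - t)) \<longlonglongrightarrow> G y \<and>
     (G has_derivative (*) (A1s t y)) (at y within ?S)"
  proof (rule has_derivative_sequence[where f'="\<lambda>n y. (*) ((A1 (u (n + n0)) y - A1 t y) / (u (n + n0) - t))"])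
    show "((\<lambda>y. (A (u (n + n0)) y - A t y) / (u (n + n0) - t)) has_derivative
        (*) ((A1 (u (n + n0)) y - A1 t y) / (u (n + n0) - t))) (at y within ?S)" if "y \<in> ?S" for n y
      using A n0[of "n + n0"] I(2) unfolding has_field_derivative_def[symmetric] C1_on_strip_def
      by (intro DERIV_cdivide DERIV_diff) (auto intro: has_field_derivative_at_within)
    show "\<forall>\<^sub>F n in sequentially. \<forall>y\<in>?S. \<forall>h. norm ((A1 (u (n + n0)) y - A1 t y) / (u (n + n0) - t) * h - A1s t y * h)
        \<le> e * norm h" if "e > 0" for e
    proof -
      have "\<forall>\<^sub>F n in sequentially. \<forall>y\<in>?S. dist ((A1 (u (n + n0)) y - A1 t y) / (u (n + n0) - t)) (A1s t y) < e"
        using eventually_sequentially_seg[THEN iffD2, OF uniform_limitD[OF lim(2) that]] by simp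
      then show ?thesis
        by eventually_elim
          (simp add: left_diff_distrib[symmetric] abs_mult dist_real_def mult_right_mono less_imp_le
            del: times_divide_eq_left)
    qed
    show "(\<lambda>n. (A (u (n + n0)) x - A t x) / (u (n + n0) - t)) \<longlonglongrightarrow> As t x"
      using LIMSEQ_ignore_initial_segment[OF tendsto_uniform_limitI[OF lim(1), of x]] by simp
  qed auto
  then obtain G where G: "\<And>y. y \<in> ?S \<Longrightarrow> (\<lambda>n. (A (u (n + n0)) y - A t y) / (u (n + n0) - t)) \<longlonglongrightarrow> G y"
    "\<And>y. y \<in> ?S \<Longrightarrow> (G has_derivative (*) (A1s t y)) (at y within ?S)"
    by blast
  have "G y = As t y" if "y \<in> ?S" for y
    using LIMSEQ_unique[OF G(1)[OF that] LIMSEQ_ignore_initial_segment[OF tendsto_uniform_limitI[OF lim(1) that]]] .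
  then have "(As t has_derivative (*) (A1s t x)) (at x within ?S)"
    using has_derivative_transform[OF _ _ G(2)[of x]] by simp
  then show ?thesis
    by (simp add: has_field_derivative_def at_within_interior[of x ?S])
qed

section \<open>From paths in \<open>C^k\<close> to functions on a strip\<close>

lemma strip_continuous:
  fixes P :: "real \<Rightarrow> real \<Rightarrow> real"
  assumes "\<And>t. t \<in> I \<Longrightarrow> continuous_on UNIV (P t)"
    and "\<And>t. t \<in> I \<Longrightarrow> uniform_limit UNIV P (P t) (at t within I)"
  shows "continuous_on (I \<times> UNIV) (\<lambda>(s, x). P s x)"
  unfolding continuous_on_iff
proof (intro ballI allI impI)
  fix p :: "real \<times> real" and e :: real
  assume "p \<in> I \<times> UNIV" and e: "0 < e"
  then obtain t x where p: "p = (t, x)" and t: "t \<in> I" by auto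
  obtain d1 where d1: "0 < d1" "\<And>y. dist y x < d1 \<Longrightarrow> dist (P t y) (P t x) < e / 2"
    using assms(1)[OF t] e unfolding continuous_on_iff by (meson UNIV_I half_gt_zero)
  have "\<forall>\<^sub>F s in at t within I. \<forall>y\<in>UNIV. dist (P s y) (P t y) < e / 2"
    using uniform_limitD[OF assms(2)[OF t], of "e / 2"] e by simp
  then obtain d2 where d2: "0 < d2" "\<And>s y. s \<in> I \<Longrightarrow> s \<noteq> t \<Longrightarrow> dist s t < d2 \<Longrightarrow> dist (P s y) (P t y) < e / 2"
    unfolding eventually_at by auto
  show "\<exists>d>0. \<forall>p'\<in>I \<times> UNIV. dist p' p < d \<longrightarrow> dist (case p' of (s, x) \<Rightarrow> P s x) (case p of (s, x) \<Rightarrow> P s x) < e"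
  proof (intro exI[of _ "min d1 d2"] conjI ballI impI)
    fix p' :: "real \<times> real" assume p': "p' \<in> I \<times> UNIV" "dist p' p < min d1 d2"
    obtain s y where sy: "p' = (s, y)" by (cases p')
    have "dist s t < d2" "dist y x < d1"
      using p'(2) dist_fst_le[of p' p] dist_snd_le[of p' p] by (auto simp: sy p)
    then have "dist (P s y) (P t y) < e / 2" "dist (P t y) (P t x) < e / 2"
      using d1 d2 p'(1) e by (cases "s = t"; simp add: sy)+
    then show "dist (case p' of (s, x) \<Rightarrow> P s x) (case p of (s, x) \<Rightarrow> P s x) < e"
      using dist_triangle[of "P s y" "P t x" "P t y"] by (simp add: sy p)
  qed (use d1 d2 in auto)
qed

text \<open>Lifts are not periodic but their differences within a family are, and this is enough for
  the norm, a supremum over \<open>{0..1}\<close>, to control the whole line.\<close>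

lemma path_deriv_uniform_limit:
  assumes "has_Ck_path_deriv k p D t I" "t \<in> I"
    and p: "\<And>s. s \<in> I \<Longrightarrow> C_k k (p s)" "\<And>s. s \<in> I \<Longrightarrow> periodic1 (\<lambda>x. p s x - p t x)"
    and D: "C_k k D" "periodic1 D" and j: "j \<le> k"
  shows "uniform_limit UNIV (\<lambda>s x. ((deriv ^^ j) (p s) x - (deriv ^^ j) (p t) x) / (s - t)) ((deriv ^^ j) D)
           (at t within I)"
proof (rule uniform_limitI)
  fix e :: real assume "0 < e"
  let ?h = "\<lambda>s x. (p s x - p t x) / (s - t) - D x"
  have "\<forall>\<^sub>F s in at t within I. s \<in> I"
    by (simp add: eventually_at_filter)
  moreover have "\<forall>\<^sub>F s in at t within I. dist (Ck_norm k (?h s)) 0 < e"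
    using assms(1) \<open>0 < e\<close> unfolding has_Ck_path_deriv_def by (rule tendstoD)
  ultimately show "\<forall>\<^sub>F s in at t within I. \<forall>x\<in>UNIV.
      dist (((deriv ^^ j) (p s) x - (deriv ^^ j) (p t) x) / (s - t)) ((deriv ^^ j) D x) < e"
  proof eventually_elim
    case (elim s)
    let ?u = "\<lambda>x. (1 / (s - t)) * p s x + (- 1 / (s - t)) * p t x"
    have h: "?h s = (\<lambda>x. 1 * ?u x + (- 1) * D x)"
      by (auto simp: diff_divide_distrib)
    note u = C_k_lincomb[OF p(1)[OF elim(1)] p(1)[OF assms(2)], where a="1 / (s - t)" and b="- 1 / (s - t)"]
    note c = C_k_lincomb[OF u(1) D(1), where a=1 and b="- 1", folded h]
    have per: "periodic1 (?h s)"
      using p(2)[OF elim(1)] D(2) unfolding periodic1_def by simp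
    have "\<bar>(deriv ^^ j) (?h s) x\<bar> < e" for x
      using Ck_norm_ge[OF c(1) per j, of x] elim(2) by (simp add: dist_real_def)
    moreover have "(deriv ^^ j) (?h s) x = ((deriv ^^ j) (p s) x - (deriv ^^ j) (p t) x) / (s - t) - (deriv ^^ j) D x" for x
      unfolding c(2)[OF j] u(2)[OF j] by (simp add: diff_divide_distrib)
    ultimately show ?case
      by (simp add: dist_real_def)
  qed
qed

text \<open>Uniform convergence of the difference quotients gives the pointwise derivative. It also
  bounds them near \<open>t\<close> by \<open>b + 1\<close>, so the derivatives of
  \<open>p s\<close> tend uniformly to those of \<open>p t\<close>, whence joint continuity.\<close>

lemma path_deriv_strip:
  assumes "open I"
    and path: "\<And>t. t \<in> I \<Longrightarrow> has_Ck_path_deriv k p (Q t) t I"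
    and p: "\<And>s. s \<in> I \<Longrightarrow> C_k k (p s)" "\<And>s t. s \<in> I \<Longrightarrow> t \<in> I \<Longrightarrow> periodic1 (\<lambda>x. p s x - p t x)"
    and Q: "\<And>s. s \<in> I \<Longrightarrow> C_k k (Q s)" "\<And>s. s \<in> I \<Longrightarrow> periodic1 (Q s)" and j: "j \<le> k"
  shows "t \<in> I \<Longrightarrow> ((\<lambda>s. (deriv ^^ j) (p s) x) has_real_derivative (deriv ^^ j) (Q t) x) (at t)"
    and "continuous_on (I \<times> UNIV) (\<lambda>(s, x). (deriv ^^ j) (p s) x)"
proof -
  let ?P = "\<lambda>s. (deriv ^^ j) (p s)"
  have U: "uniform_limit UNIV (\<lambda>s x. (?P s x - ?P t x) / (s - t)) ((deriv ^^ j) (Q t)) (at t within I)" if "t \<in> I" for t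
    using path_deriv_uniform_limit[OF path[OF that] that p(1) p(2)[OF _ that] Q(1)[OF that] Q(2)[OF that] j] by blast
  show "((\<lambda>s. ?P s x) has_real_derivative (deriv ^^ j) (Q t) x) (at t)" if "t \<in> I" for x t
    using tendsto_uniform_limitI[OF U[OF that], of x] at_within_open[OF that assms(1)]
    by (simp add: has_field_derivative_iff)
  show "continuous_on (I \<times> UNIV) (\<lambda>(s, x). ?P s x)"
  proof (rule strip_continuous)
    fix t assume t: "t \<in> I"
    show "continuous_on UNIV (?P t)"
      by (rule C_k_continuous[OF p(1)[OF t] j])
    obtain b where b: "0 \<le> b" "\<And>x. \<bar>(deriv ^^ j) (Q t) x\<bar> \<le> b"
      using periodic1_bounded[OF C_k_continuous[OF Q(1)[OF t] j] C_k_periodic_deriv[OF Q(1,2)[OF t] j]] by blast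
    show "uniform_limit UNIV ?P (?P t) (at t within I)"
    proof (rule uniform_limitI)
      fix e :: real assume e: "0 < e"
      have "\<forall>\<^sub>F s in at t within I. dist s t < e / (b + 1)"
        using e b(1) by (intro tendstoD[OF tendsto_ident_at]) simp
      moreover have "\<forall>\<^sub>F s in at t within I. s \<noteq> t"
        by (simp add: eventually_at_filter)
      moreover have "\<forall>\<^sub>F s in at t within I. \<forall>x\<in>UNIV. dist ((?P s x - ?P t x) / (s - t)) ((deriv ^^ j) (Q t) x) < 1"
        by (rule uniform_limitD[OF U[OF t]]) simp
      ultimately show "\<forall>\<^sub>F s in at t within I. \<forall>x\<in>UNIV. dist (?P s x) (?P t x) < e"
      proof eventually_elim
        case (elim s)
        show ?case
        proof
          fix x
          have "\<bar>(?P s x - ?P t x) / (s - t)\<bar> \<le> b + 1"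
            using bspec[OF elim(3) UNIV_I, of x] b(2)[of x] unfolding dist_real_def by linarith
          then have "\<bar>?P s x - ?P t x\<bar> \<le> (b + 1) * \<bar>s - t\<bar>"
            using elim(2) by (simp add: abs_divide pos_divide_le_eq)
          also have "\<dots> < e"
            using elim(1) b(1) by (simp add: dist_real_def field_simps)
          finally show "dist (?P s x) (?P t x) < e"
            by (simp add: dist_real_def)
        qed
      qed
    qed
  qed
qed

section \<open>Families of expanding lifts\<close>

lemma MVT_unordered:
  fixes F F' :: "real \<Rightarrow> real"
  assumes "\<And>x. (F has_real_derivative F' x) (at x)"
  shows "\<exists>z. \<bar>z - a\<bar> \<le> \<bar>b - a\<bar> \<and> F b - F a = (b - a) * F' z"
proof (cases a b rule: linorder_cases)
  case less
  from MVT2[OF less, of F F'] assms obtain z where "a < z" "z < b" "F b - F a = (b - a) * F' z"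
    by blast
  then show ?thesis by (intro exI[of _ z]) auto
next
  case greater
  from MVT2[OF greater, of F F'] assms obtain z where "b < z" "z < a" "F a - F b = (a - b) * F' z"
    by blast
  then show ?thesis by (intro exI[of _ z]) (auto simp: algebra_simps)
qed auto

text \<open>The same \<open>\<sigma>\<close>, \<open>N\<close>, \<open>lam\<close> and
  \<open>B\<close> serve all parameters, so the resolvent constants are common. Since convergence is
  sought in \<open>C^1\<close>, the second spatial derivative must also be differentiable in the
  parameter.\<close>

locale expanding_family =
  fixes I :: "real set" and f f1 f2 f3 q q1 q2 :: "real \<Rightarrow> real \<Rightarrow> real"
    and \<sigma> lam B :: real and N :: nat
  assumes open_I: "open I"
    and lift: "s \<in> I \<Longrightarrow> expanding_lift (f s) (f1 s) (f2 s) \<sigma> lam B N"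
    and f_strip: "C1_on_strip I f q f1"
    and f1_strip: "C1_on_strip I f1 q1 f2"
    and f2_strip: "C1_on_strip I f2 q2 f3"
begin

abbreviation "G s \<equiv> expanding_lift.g (f s)"
abbreviation "G1 s \<equiv> expanding_lift.g1 (f s) (f1 s)"
abbreviation "G2 s \<equiv> expanding_lift.g2 (f s) (f1 s) (f2 s)"
abbreviation "LL s \<equiv> expanding_branches.L (G s) (G1 s) \<sigma> N"
abbreviation "LL' s \<equiv> expanding_branches.L' (G s) (G1 s) (G2 s) \<sigma> N"

section \<open>Dependence of the inverse lift on the parameter\<close>

lemma G_parameter_bound:
  assumes "s \<in> I" "t \<in> I"
  shows "\<bar>G s x - G t x\<bar> \<le> \<bar>f s (G t x) - f t (G t x)\<bar>"
proof -
  interpret s: expanding_lift "f s" "f1 s" "f2 s" \<sigma> lam B N by (rule lift[OF assms(1)])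
  interpret t: expanding_lift "f t" "f1 t" "f2 t" \<sigma> lam B N by (rule lift[OF assms(2)])
  \<comment> \<open>The 1-Lipschitz map \<open>G s\<close> sends \<open>f s (G t x)\<close> to
    \<open>G t x\<close>, and \<open>x\<close> equals \<open>f t (G t x)\<close>.\<close>
  show ?thesis
    using s.g_lipschitz[of x "f s (G t x)"] by (simp add: abs_minus_commute)
qed

text \<open>The Lipschitz bound handles the spatial variable uniformly in \<open>s\<close>; what
  remains is the variation of \<open>f s\<close> at the fixed point \<open>G t x\<close>.\<close>

lemma G_continuous: "continuous_on (I \<times> UNIV) (\<lambda>(s, x). G s x)"
  unfolding continuous_on_def
proof
  fix p :: "real \<times> real" assume "p \<in> I \<times> UNIV"
  then obtain t x where p: "p = (t, x)" and t: "t \<in> I" by auto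
  let ?F = "at (t, x) within I \<times> UNIV"
  interpret t: expanding_lift "f t" "f1 t" "f2 t" \<sigma> lam B N by (rule lift[OF t])
  have "((\<lambda>(s, y). G s y) \<longlongrightarrow> G t x) ?F"
  proof (rule Lim_null_comparison[where g="\<lambda>p. \<bar>snd p - x\<bar> + \<bar>f (fst p) (G t x) - f t (G t x)\<bar>", THEN Lim_null[THEN iffD2]])
    have "\<forall>\<^sub>F p in ?F. p \<in> I \<times> UNIV"
      by (simp add: eventually_at_filter)
    then show "\<forall>\<^sub>F p in ?F. norm ((case p of (s, y) \<Rightarrow> G s y) - G t x)
        \<le> \<bar>snd p - x\<bar> + \<bar>f (fst p) (G t x) - f t (G t x)\<bar>"
    proof eventually_elim
      fix p :: "real \<times> real" assume "p \<in> I \<times> UNIV"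
      then obtain s y where p: "p = (s, y)" and s: "s \<in> I" by auto
      interpret s: expanding_lift "f s" "f1 s" "f2 s" \<sigma> lam B N by (rule lift[OF s])
      show "norm ((case p of (s, y) \<Rightarrow> G s y) - G t x)
        \<le> \<bar>snd p - x\<bar> + \<bar>f (fst p) (G t x) - f t (G t x)\<bar>"
        using s.g_lipschitz[of y x] G_parameter_bound[OF s t, of x] by (simp add: p)
    qed
    have "((\<lambda>s. f s (G t x)) has_real_derivative q t (G t x)) (at t)"
      using f_strip t by (simp add: C1_on_strip_def)
    from isCont_tendsto_compose[OF DERIV_isCont[OF this], of "\<lambda>p. fst p" ?F]
    have "((\<lambda>p. f (fst p) (G t x)) \<longlongrightarrow> f t (G t x)) ?F"
      using tendsto_fst[OF tendsto_ident_at[of "(t, x)" "I \<times> UNIV"]] by simp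
    then have "((\<lambda>p. \<bar>snd p - x\<bar> + \<bar>f (fst p) (G t x) - f t (G t x)\<bar>) \<longlongrightarrow> \<bar>x - x\<bar> + \<bar>f t (G t x) - f t (G t x)\<bar>) ?F"
      by (intro tendsto_intros) (auto intro!: tendsto_eq_intros)
    then show "((\<lambda>p. \<bar>snd p - x\<bar> + \<bar>f (fst p) (G t x) - f t (G t x)\<bar>) \<longlongrightarrow> 0) ?F"
      by simp
  qed
  then show "((\<lambda>(s, x). G s x) \<longlongrightarrow> (case p of (s, x) \<Rightarrow> G s x)) (at p within I \<times> UNIV)"
    by (simp add: p)
qed

text \<open>Implicit differentiation by hand. With \<open>y = G t x\<close> one has
  \<open>f s (G s x) = f t y\<close>, so the mean value theorem for \<open>f s\<close> between
  \<open>y\<close> and \<open>G s x\<close> writes the quotient of \<open>G\<close> as minus that of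
  \<open>f\<close> at \<open>y\<close>, divided by \<open>f1 s (z s)\<close>. Squeezing gives
  \<open>z s \<rightarrow> y\<close>, and \<open>f1\<close> is jointly continuous.\<close>

lemma G_parameter_DERIV:
  assumes t: "t \<in> I"
  shows "((\<lambda>s. G s x) has_real_derivative - q t (G t x) / f1 t (G t x)) (at t)"
proof -
  interpret t: expanding_lift "f t" "f1 t" "f2 t" \<sigma> lam B N by (rule lift[OF t])
  define y where "y = G t x"
  have ev: "\<forall>\<^sub>F s in at t. s \<in> I"
    using eventually_at_in_open'[OF open_I t] .
  have D: "((\<lambda>s. f s y) has_real_derivative q t y) (at t)"
    using f_strip t by (simp add: C1_on_strip_def)
  have "\<exists>z. \<bar>z - y\<bar> \<le> \<bar>G s x - y\<bar> \<and> f s (G s x) - f s y = (G s x - y) * f1 s z" if "s \<in> I" for s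
    using MVT_unordered[of "f s" "f1 s" y "G s x"] f_strip that by (auto simp: C1_on_strip_def)
  then obtain z where z: "\<And>s. s \<in> I \<Longrightarrow> \<bar>z s - y\<bar> \<le> \<bar>G s x - y\<bar>"
    "\<And>s. s \<in> I \<Longrightarrow> f s (G s x) - f s y = (G s x - y) * f1 s (z s)"
    by metis
  have "(z \<longlongrightarrow> y) (at t)"
  proof (rule Lim_null_comparison[where g="\<lambda>s. \<bar>f s y - f t y\<bar>", THEN Lim_null[THEN iffD2]])
    show "\<forall>\<^sub>F s in at t. norm (z s - y) \<le> \<bar>f s y - f t y\<bar>"
      using ev
    proof eventually_elim
      case (elim s)
      then show ?case
        using z(1)[OF elim] G_parameter_bound[OF elim t, of x] by (simp add: y_def)
    qed
    have "((\<lambda>s. f s y) \<longlongrightarrow> f t y) (at t)"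
      using DERIV_isCont[OF D] by (simp add: isCont_def)
    from tendsto_rabs[OF LIM_zero[OF this]] show "((\<lambda>s. \<bar>f s y - f t y\<bar>) \<longlongrightarrow> 0) (at t)"
      by simp
  qed
  then have lim: "((\<lambda>s. (s, z s)) \<longlongrightarrow> (t, y)) (at t)"
    by (intro tendsto_intros) auto
  have "isCont (\<lambda>(s, x). f1 s x) (t, y)"
    using C1_on_strip_imp_continuous[OF f1_strip open_I] t open_I
    by (auto simp: continuous_on_eq_continuous_at open_Times)
  from isCont_tendsto_compose[OF this lim] have f1_lim: "((\<lambda>s. f1 s (z s)) \<longlongrightarrow> f1 t y) (at t)"
    by simp
  have "((\<lambda>s. - ((f s y - f t y) / (s - t)) / f1 s (z s)) \<longlongrightarrow> - q t y / f1 t y) (at t)"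
    using D t.F1_nonzero by (intro tendsto_intros f1_lim) (auto simp: has_field_derivative_iff)
  moreover have "\<forall>\<^sub>F s in at t. - ((f s y - f t y) / (s - t)) / f1 s (z s) = (G s x - G t x) / (s - t)"
    using ev
  proof eventually_elim
    case (elim s)
    interpret s: expanding_lift "f s" "f1 s" "f2 s" \<sigma> lam B N by (rule lift[OF elim])
    have "(f s y - f t y) = - ((G s x - G t x) * f1 s (z s))"
      using z(2)[OF elim] by (simp add: y_def)
    then show ?case
      using s.F1_nonzero by simp
  qed
  ultimately show ?thesis
    unfolding has_field_derivative_iff y_def[symmetric] by (rule Lim_transform_eventually[where f="\<lambda>s. _ s"])
qed

lemma G_strip: "C1_on_strip I G (\<lambda>s x. - q s (G s x) / f1 s (G s x)) (\<lambda>s x. 1 / f1 s (G s x))"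
  unfolding C1_on_strip_def
proof (intro conjI ballI allI)
  have nz: "f1 s x \<noteq> 0" if "s \<in> I" for s x
    using expanding_lift.F1_nonzero[OF lift[OF that]] .
  have c: "continuous_on (I \<times> UNIV) (\<lambda>(s, x). q s (G s x))" "continuous_on (I \<times> UNIV) (\<lambda>(s, x). f1 s (G s x))"
    using f_strip by (auto simp: C1_on_strip_def intro!: continuous_on_strip_compose[OF _ G_continuous])
  then show "continuous_on (I \<times> UNIV) (\<lambda>(s, x). - q s (G s x) / f1 s (G s x))"
    "continuous_on (I \<times> UNIV) (\<lambda>(s, x). 1 / f1 s (G s x))"
    unfolding case_prod_beta using nz by (auto intro!: continuous_intros)
qed (rule G_parameter_DERIV expanding_lift.g_DERIV[OF lift], assumption)+

lemma const_strip: "C1_on_strip I (\<lambda>s x. r) (\<lambda>s x. 0) (\<lambda>s x. 0)"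
  by (rule C1_on_strip_fst_const) auto

lemma G1_strip: obtains G1s where "C1_on_strip I G1 G1s G2"
proof -
  have nz: "f1 s x \<noteq> 0" if "s \<in> I" for s x
    using expanding_lift.F1_nonzero[OF lift[OF that]] .
  show ?thesis
    by (rule that, rule C1_on_strip_cong[OF
          C1_on_strip_inverse[OF C1_on_strip_compose[OF f1_strip G_strip open_I] nz open_I] open_I])
       (auto simp: expanding_lift.g1_def[OF lift] expanding_lift.g2_def[OF lift] field_simps power3_eq_cube)
qed

lemma G2_strip: obtains G2s G2x where "C1_on_strip I G2 G2s G2x"
proof -
  obtain G1s where G1: "C1_on_strip I G1 G1s G2"
    by (rule G1_strip)
  note cube = C1_on_strip_mult[OF G1 C1_on_strip_mult[OF G1 G1 open_I] open_I]
  note f2G = C1_on_strip_compose[OF f2_strip G_strip open_I]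
  show ?thesis
    by (rule that, rule C1_on_strip_cong[OF C1_on_strip_mult[OF const_strip[of "- 1"]
            C1_on_strip_mult[OF f2G cube open_I] open_I] open_I])
       ((simp add: expanding_lift.g1_def[OF lift] expanding_lift.g2_def[OF lift] power3_eq_cube; fail) | rule refl)+
qed

section \<open>Dependence of the operators on the parameter\<close>

lemma C1_periodic_strip: "C1_periodic \<phi> \<Longrightarrow> C1_on_strip I (\<lambda>s. \<phi>) (\<lambda>s x. 0) (\<lambda>s. deriv \<phi>)"
  by (intro C1_on_strip_fst_const C1_periodic_DERIV C1_periodic_continuous_deriv)

lemma LL_strip:
  assumes \<phi>: "C1_periodic \<phi>"
  obtains As where "C1_on_strip I (\<lambda>s. LL s \<phi>) As (\<lambda>s. LL' s \<phi>)"
proof -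
  obtain G1s where G1: "C1_on_strip I G1 G1s G2"
    by (rule G1_strip)
  note summand = C1_on_strip_mult[OF C1_on_strip_compose[OF C1_periodic_strip[OF \<phi>] G_strip open_I]
      C1_on_strip_mult[OF const_strip[of \<sigma>] G1 open_I] open_I]
  show ?thesis
  proof (rule that, rule C1_on_strip_cong[OF
        C1_on_strip_sum[OF C1_on_strip_shift[OF summand], of real "{..<N}"] open_I])
    fix s x assume s: "s \<in> I"
    interpret s: expanding_lift "f s" "f1 s" "f2 s" \<sigma> lam B N by (rule lift[OF s])
    show "s.L \<phi> x = (\<Sum>k<N. \<phi> (s.g (x + real k)) * (\<sigma> * s.g1 (x + real k)))"
      by (rule s.L_def)
    show "s.L' \<phi> x = (\<Sum>k<N. deriv \<phi> (s.g (x + real k)) * (1 / f1 s (s.g (x + real k))) * (\<sigma> * s.g1 (x + real k)) +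
        \<phi> (s.g (x + real k)) * (0 * s.g1 (x + real k) + \<sigma> * s.g2 (x + real k)))"
      by (auto simp: s.L'_def s.g1_def power2_eq_square intro!: sum.cong)
  qed (rule refl)
qed

lemma LL'_strip:
  assumes \<phi>: "C1_periodic \<phi>" "C1_periodic (deriv \<phi>)"
  obtains As Ax where "C1_on_strip I (\<lambda>s. LL' s \<phi>) As Ax"
proof -
  obtain G1s where G1: "C1_on_strip I G1 G1s G2"
    by (rule G1_strip)
  obtain G2s G2x where G2: "C1_on_strip I G2 G2s G2x"
    by (rule G2_strip)
  note summand = C1_on_strip_add[OF
      C1_on_strip_mult[OF C1_on_strip_compose[OF C1_periodic_strip[OF \<phi>(2)] G_strip open_I]
        C1_on_strip_mult[OF const_strip[of \<sigma>] C1_on_strip_mult[OF G1 G1 open_I] open_I] open_I]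
      C1_on_strip_mult[OF C1_on_strip_compose[OF C1_periodic_strip[OF \<phi>(1)] G_strip open_I]
        C1_on_strip_mult[OF const_strip[of \<sigma>] G2 open_I] open_I]]
  show ?thesis
  proof (rule that, rule C1_on_strip_cong[OF
        C1_on_strip_sum[OF C1_on_strip_shift[OF summand], of real "{..<N}"] open_I])
    fix s x assume s: "s \<in> I"
    interpret s: expanding_lift "f s" "f1 s" "f2 s" \<sigma> lam B N by (rule lift[OF s])
    show "s.L' \<phi> x = (\<Sum>k<N. deriv \<phi> (s.g (x + real k)) * (\<sigma> * (s.g1 (x + real k) * s.g1 (x + real k))) +
        \<phi> (s.g (x + real k)) * (\<sigma> * s.g2 (x + real k)))"
      by (simp add: s.L'_def power2_eq_square)
  qed (rule refl)+
qed

text \<open>Differentiating \<open>f s (G s x) = x\<close> in \<open>s\<close> gives \<open>\<partial>\<^sub>s G s x = - X s x * G1 s x\<close>. Hence an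
  antiderivative of \<open>LL s \<phi>\<close> has \<open>s\<close>-derivative \<open>- X s x * LL s \<phi> x\<close>, and interchanging the two
  derivatives yields that of \<open>LL s \<phi>\<close>.\<close>

lemma LL_parameter_derivative:
  assumes \<phi>: "C1_periodic \<phi>" and t: "t \<in> I"
    and X: "periodic1 X" "\<And>y. q t y = X (f t y)"
    and As: "C1_on_strip I (\<lambda>s. LL s \<phi>) As (\<lambda>s. LL' s \<phi>)"
  shows "((\<lambda>x. - (X x * LL t \<phi> x)) has_real_derivative As t x) (at x)"
proof -
  obtain R where R: "\<And>x. (R has_real_derivative \<phi> x) (at x)"
    using antiderivative_UNIV[OF C1_periodic_imp_continuous[OF \<phi>]] by blast
  have R_strip: "C1_on_strip I (\<lambda>s. R) (\<lambda>s x. 0) (\<lambda>s. \<phi>)"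
    by (rule C1_on_strip_fst_const[OF R C1_periodic_imp_continuous[OF \<phi>]])
  note summand = C1_on_strip_mult[OF const_strip[of \<sigma>] C1_on_strip_compose[OF R_strip G_strip open_I] open_I]
  let ?Us = "\<lambda>s x. \<Sum>k<N. \<sigma> * (\<phi> (G s (x + real k)) * (- q s (G s (x + real k)) / f1 s (G s (x + real k))))"
  have U: "C1_on_strip I (\<lambda>s x. \<Sum>k<N. \<sigma> * R (G s (x + real k))) ?Us (\<lambda>s. LL s \<phi>)"
  proof (rule C1_on_strip_cong[OF
        C1_on_strip_sum[OF C1_on_strip_shift[OF summand], of real "{..<N}"] open_I])
    fix s x assume s: "s \<in> I"
    interpret s: expanding_lift "f s" "f1 s" "f2 s" \<sigma> lam B N by (rule lift[OF s])
    show "s.L \<phi> x = (\<Sum>k<N. 0 * R (s.g (x + real k)) + \<sigma> * (\<phi> (s.g (x + real k)) * (1 / f1 s (s.g (x + real k)))))"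
      by (simp add: s.L_def s.g1_def algebra_simps)
  qed auto
  interpret t: expanding_lift "f t" "f1 t" "f2 t" \<sigma> lam B N by (rule lift[OF t])
  have "?Us t = (\<lambda>x. - (X x * t.L \<phi> x))"
  proof
    fix x
    \<comment> \<open>At every preimage of \<open>x\<close> the velocity is
      \<open>X (x + k) = X x\<close>, a common factor of the sum.\<close>
    have "?Us t x = (\<Sum>k<N. - (X x * (\<phi> (t.g (x + real k)) * (\<sigma> * t.g1 (x + real k)))))"
      by (intro sum.cong) (auto simp: X(2) periodic1_add_nat[OF X(1)] t.g1_def)
    then show "?Us t x = - (X x * t.L \<phi> x)"
      by (simp add: t.L_def sum_distrib_left sum_negf)
  qed
  with strip_mixed_derivative[OF U As open_I t, of x] show ?thesis
    by simp
qed

section \<open>Convergence of the difference quotients of the densities\<close>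

lemma linear_response_of_family:
  fixes \<rho> :: "real \<Rightarrow> real \<Rightarrow> real" and X :: "real \<Rightarrow> real"
  assumes t: "t \<in> I"
    and \<rho>: "\<And>s. s \<in> I \<Longrightarrow> C1_periodic (\<rho> s)" "\<And>s. s \<in> I \<Longrightarrow> integral {0..1} (\<rho> s) = 1"
      "\<And>s. s \<in> I \<Longrightarrow> LL s (\<rho> s) = \<rho> s"
    and \<rho>2: "C1_periodic (deriv (\<rho> t))"
    and X: "C1_periodic X" "C1_periodic (deriv X)" "\<And>y. q t y = X (f t y)"
  shows "has_Ck_path_deriv 1 \<rho>
      (\<lambda>x. - zero_mean_inverse (transfer (f t)) (deriv (\<lambda>y. X y * \<rho> t y)) x) t I"
proof -
  interpret t: expanding_lift "f t" "f1 t" "f2 t" \<sigma> lam B N by (rule lift[OF t])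
  define \<psi> where "\<psi> = deriv (\<lambda>y. X y * \<rho> t y)"
  define \<eta> where "\<eta> = zero_mean_inverse (transfer (f t)) \<psi>"
  note \<rho>t = \<rho>(1)[OF t]
  have D\<psi>: "((\<lambda>y. X y * \<rho> t y) has_real_derivative deriv X x * \<rho> t x + deriv (\<rho> t) x * X x) (at x)" for x
    by (intro DERIV_mult C1_periodic_DERIV X \<rho>t)
  then have \<psi>_eq: "\<psi> = (\<lambda>x. deriv X x * \<rho> t x + deriv (\<rho> t) x * X x)"
    by (auto simp: \<psi>_def DERIV_imp_deriv)
  have \<psi>_DERIV: "((\<lambda>y. X y * \<rho> t y) has_real_derivative \<psi> x) (at x)" for x
    using D\<psi> by (simp add: \<psi>_eq)
  have per: "periodic1 (\<lambda>y. X y * \<rho> t y)"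
    using X(1) \<rho>t by (auto simp: C1_periodic_def periodic1_def)
  have \<psi>: "C1_periodic \<psi>"
  proof (rule C1_periodicI)
    show "periodic1 \<psi>"
      by (rule periodic1_deriv[OF periodic1_imp_is_lift[OF per] \<psi>_DERIV])
    show "(\<psi> has_real_derivative (deriv (deriv X) x * \<rho> t x + deriv (\<rho> t) x * deriv X x)
        + (deriv (deriv (\<rho> t)) x * X x + deriv X x * deriv (\<rho> t) x)) (at x)" for x
      unfolding \<psi>_eq by (intro DERIV_add DERIV_mult C1_periodic_DERIV X \<rho>t \<rho>2)
    show "continuous_on UNIV (\<lambda>x. (deriv (deriv X) x * \<rho> t x + deriv (\<rho> t) x * deriv X x)
        + (deriv (deriv (\<rho> t)) x * X x + deriv X x * deriv (\<rho> t) x))"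
      by (intro continuous_intros C1_periodic_continuous_deriv X \<rho>t \<rho>2
          C1_periodic_imp_continuous)
  qed
  have "integral {0..1} \<psi> = X 1 * \<rho> t 1 - X 0 * \<rho> t 0"
    by (rule integral_unique[OF FTC_unit_interval[OF \<psi>_DERIV]])
  moreover have "X (0 + 1) * \<rho> t (0 + 1) = X 0 * \<rho> t 0"
    using per unfolding periodic1_def by blast
  ultimately have "integral {0..1} \<psi> = 0"
    by simp
  note \<eta> = t.zero_mean_inverse_transfer[OF \<psi> this, folded \<eta>_def]
  obtain As where As: "C1_on_strip I (\<lambda>s. LL s (\<rho> t)) As (\<lambda>s. LL' s (\<rho> t))"
    by (rule LL_strip[OF \<rho>t])
  obtain Bs Bx where Bs: "C1_on_strip I (\<lambda>s. LL' s (\<rho> t)) Bs Bx"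
    by (rule LL'_strip[OF \<rho>t \<rho>2])
  \<comment> \<open>\<open>\<eta>\<close> is known to be \<open>C^1\<close> only, which gives joint
    continuity of \<open>LL' s \<eta>\<close>. This suffices because the \<open>\<eta>\<close> terms
    are not divided by \<open>s - t\<close>.\<close>
  obtain Es where Es: "C1_on_strip I (\<lambda>s. LL s \<eta>) Es (\<lambda>s. LL' s \<eta>)"
    by (rule LL_strip[OF \<eta>(1)])
  \<comment> \<open>Invariance of \<open>\<rho> t\<close> turns the parameter derivative of
    \<open>LL s (\<rho> t)\<close> at \<open>t\<close> into \<open>- \<psi>\<close>.\<close>
  have As_eq: "As t x = - \<psi> x" for x
    using LL_parameter_derivative[OF \<rho>t t C1_periodic_imp_periodic[OF X(1)] X(3) As, of x]
      DERIV_minus[OF \<psi>_DERIV[of x]] by (simp add: \<rho>(3)[OF t] DERIV_unique)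
  \<comment> \<open>A second interchange of derivatives identifies the parameter derivative of
    \<open>LL' s (\<rho> t)\<close>.\<close>
  have "((\<lambda>x. - \<psi> x) has_real_derivative Bs t x) (at x)" for x
    using strip_mixed_derivative[OF As Bs open_I t, of x] ext[of "As t" "\<lambda>x. - \<psi> x", OF As_eq] by simp
  then have Bs_eq: "Bs t x = - deriv \<psi> x" for x
    using DERIV_minus[OF C1_periodic_DERIV[OF \<psi>, of x]] DERIV_unique by blast
  have lims: "uniform_limit {0..1} (\<lambda>s x. (LL s (\<rho> t) x - LL t (\<rho> t) x) / (s - t)) (As t) (at t)"
    "uniform_limit {0..1} (\<lambda>s x. (LL' s (\<rho> t) x - LL' t (\<rho> t) x) / (s - t)) (Bs t) (at t)"
    "uniform_limit {0..1} (\<lambda>s. LL s \<eta>) (LL t \<eta>) (at t)"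
    "uniform_limit {0..1} (\<lambda>s. LL' s \<eta>) (LL' t \<eta>) (at t)"
    using strip_uniform_difference_quotient[OF As open_I t compact_Icc]
      strip_uniform_difference_quotient[OF Bs open_I t compact_Icc]
      strip_uniform_limit[OF C1_on_strip_imp_continuous[OF Es open_I] open_I t compact_Icc]
      strip_uniform_limit[OF _ open_I t compact_Icc, of "\<lambda>s. LL' s \<eta>"] Es
    by (auto simp: C1_on_strip_def)
  let ?h = "\<lambda>s x. (\<rho> s x - \<rho> t x) / (s - t) - - \<eta> x"
  \<comment> \<open>\<open>K\<close> and \<open>c\<close> are determined by \<open>lam\<close> and
    \<open>B\<close>, so the bound formed at \<open>t\<close> is also the one for the operator at
    \<open>s\<close>.\<close>
  define M where "M = t.K / t.c"
  have M0: "0 \<le> M"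
    using t.K_nonneg t.c_bounds by (simp add: M_def)
  have key: "C1_periodic (?h s) \<and> (\<forall>x. \<bar>?h s x\<bar> \<le> M * (2 * d)) \<and> (\<forall>x. \<bar>deriv (?h s) x\<bar> \<le> M * (2 * d))"
    if s: "s \<in> I" "s \<noteq> t"
      and b: "\<forall>x\<in>{0..1}. dist ((LL s (\<rho> t) x - LL t (\<rho> t) x) / (s - t)) (As t x) < d"
        "\<forall>x\<in>{0..1}. dist ((LL' s (\<rho> t) x - LL' t (\<rho> t) x) / (s - t)) (Bs t x) < d"
        "\<forall>x\<in>{0..1}. dist (LL s \<eta> x) (LL t \<eta> x) < d"
        "\<forall>x\<in>{0..1}. dist (LL' s \<eta> x) (LL' t \<eta> x) < d" for s d
  proof -
    interpret s: expanding_lift "f s" "f1 s" "f2 s" \<sigma> lam B N by (rule lift[OF s(1)])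
    have h_eq: "?h s = (\<lambda>x. (1 / (s - t)) * (\<rho> s x - \<rho> t x) - (- 1) * \<eta> x)"
      by auto
    have h: "C1_periodic (?h s)"
      unfolding h_eq by (intro C1_periodic_diff(1) C1_periodic_cmult(1) \<rho>(1) s t \<eta>)
    have int: "\<rho> s integrable_on {0..1}" "\<rho> t integrable_on {0..1}" "\<eta> integrable_on {0..1}"
      by (intro integrable_continuous_real C1_periodic_imp_continuous \<rho>(1) s t \<eta>)+
    have h0: "integral {0..1} (?h s) = 0"
    proof -
      have "((\<lambda>x. (1 / (s - t)) * (\<rho> s x - \<rho> t x) - (- 1) * \<eta> x) has_integral
          (1 / (s - t)) * (1 - 1) - (- 1) * 0) {0..1}"
        using integrable_integral[OF int(1)] integrable_integral[OF int(2)] integrable_integral[OF int(3)]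
          \<rho>(2)[OF s(1)] \<rho>(2)[OF t] \<eta>(2)
        by (intro has_integral_diff has_integral_mult_right) auto
      then show ?thesis
        unfolding h_eq by (simp add: integral_unique)
    qed
    define w where "w = (\<lambda>x. ?h s x - s.L (?h s) x)"
    have w: "C1_periodic w" and w': "deriv w x = deriv (?h s) x - s.L' (?h s) x" for x
      using C1_periodic_diff[OF h s.L_C1_periodic[OF h]] s.deriv_L[OF h] by (auto simp: w_def)
    have "s.L (?h s) x = (s.L (\<rho> s) x - s.L (\<rho> t) x) / (s - t) + s.L \<eta> x" for x
      by (simp add: s.L_def sum_subtractf sum.distrib sum_divide_distrib diff_divide_distrib algebra_simps)
    \<comment> \<open>The two fixed-point equations and \<open>\<eta> - LL t \<eta> = \<psi>\<close>
      eliminate \<open>\<rho> s\<close>; no prior regularity in the parameter is assumed of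
      it.\<close>
    then have w_eq: "w = (\<lambda>x. (s.L (\<rho> t) x - t.L (\<rho> t) x) / (s - t) + \<psi> x - (s.L \<eta> x - t.L \<eta> x))"
      unfolding w_def
      by (auto simp: fun_eq_iff \<rho>(3)[OF s(1)] \<rho>(3)[OF t] \<eta>(3)[symmetric] diff_divide_distrib)
    have w'_eq: "deriv w x = (s.L' (\<rho> t) x - t.L' (\<rho> t) x) / (s - t) + deriv \<psi> x - (s.L' \<eta> x - t.L' \<eta> x)" for x
      unfolding w_eq
      by (intro DERIV_imp_deriv DERIV_diff DERIV_add DERIV_cdivide s.L_DERIV t.L_DERIV \<rho>t \<eta> C1_periodic_DERIV \<psi>)
    have "\<bar>w x\<bar> \<le> 2 * d" if "x \<in> {0..1}" for x
    proof -
      have "\<bar>(s.L (\<rho> t) x - t.L (\<rho> t) x) / (s - t) + \<psi> x\<bar> < d" "\<bar>s.L \<eta> x - t.L \<eta> x\<bar> < d"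
        using b(1,3) that by (auto simp: dist_real_def As_eq)
      then show ?thesis
        unfolding w_eq by linarith
    qed
    then have w_bound: "\<bar>w x\<bar> \<le> 2 * d" for x
      using periodic1_ball[OF C1_periodic_imp_periodic[OF w], where P="\<lambda>y. \<bar>y\<bar> \<le> 2 * d"] by blast
    have "\<bar>deriv w x\<bar> \<le> 2 * d" if "x \<in> {0..1}" for x
    proof -
      have "\<bar>(s.L' (\<rho> t) x - t.L' (\<rho> t) x) / (s - t) + deriv \<psi> x\<bar> < d" "\<bar>s.L' \<eta> x - t.L' \<eta> x\<bar> < d"
        using b(2,4) that by (auto simp: dist_real_def Bs_eq)
      then show ?thesis
        unfolding w'_eq by linarith
    qed
    moreover have "periodic1 (deriv w)"
      by (rule periodic1_deriv[OF periodic1_imp_is_lift[OF C1_periodic_imp_periodic[OF w]] C1_periodic_DERIV[OF w]])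
    ultimately have w'_bound: "\<bar>deriv w x\<bar> \<le> 2 * d" for x
      using periodic1_ball[where \<phi>="deriv w" and P="\<lambda>y. \<bar>y\<bar> \<le> 2 * d"] by blast
    have "\<bar>?h s x\<bar> \<le> M * (2 * d)" "\<bar>deriv (?h s) x\<bar> \<le> M * (2 * d)" for x
      unfolding M_def
      using w_bound[unfolded w_def] w'_bound[unfolded w']
      by (rule s.resolvent_bound[OF h h0])+
    then show ?thesis
      using h by blast
  qed
  have "((\<lambda>s. Ck_norm 1 (?h s)) \<longlongrightarrow> 0) (at t within I)"
  proof (rule tendstoI)
    fix e :: real assume e: "0 < e"
    define d where "d = e / (2 * (M + 1))"
    have d: "0 < d" "M * (2 * d) < e"
      using e M0 by (auto simp: d_def field_simps)
    have "\<forall>\<^sub>F s in at t. dist (Ck_norm 1 (?h s)) 0 < e"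
      using uniform_limitD[OF lims(1) d(1)] uniform_limitD[OF lims(2) d(1)]
        uniform_limitD[OF lims(3) d(1)] uniform_limitD[OF lims(4) d(1)]
        eventually_at_in_open'[OF open_I t] eventually_neq_at_within[of t t UNIV]
    proof eventually_elim
      case (elim s)
      then have k: "C1_periodic (?h s)" "\<And>x. \<bar>?h s x\<bar> \<le> M * (2 * d)" "\<And>x. \<bar>deriv (?h s) x\<bar> \<le> M * (2 * d)"
        using key[of s d] by blast+
      have "Ck_norm 1 (?h s) \<le> M * (2 * d)"
        by (rule Ck_norm_1_le[OF k(2,3)])
      moreover have "0 \<le> Ck_norm 1 (?h s)"
        using order_trans[OF abs_ge_zero Ck_norm_ge[of 1 "?h s" 0 0]] k(1) unfolding C1_periodic_def by simp
      ultimately show ?case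
        using d(2) by (simp add: dist_real_def)
    qed
    then show "\<forall>\<^sub>F s in at t within I. dist (Ck_norm 1 (?h s)) 0 < e"
      using at_within_open[OF t open_I] by simp
  qed
  then show ?thesis
    unfolding has_Ck_path_deriv_def \<eta>_def \<psi>_def .
qed

end

section \<open>Linear response for the given path of circle maps\<close>

theorem theorem2p2:
  fixes lam \<epsilon> :: real
    and f :: "real \<Rightarrow> real \<Rightarrow> real"
    and \<rho> :: "real \<Rightarrow> real \<Rightarrow> real"
    and X :: "real \<Rightarrow> real \<Rightarrow> real"
  defines "I \<equiv> {-\<epsilon><..<\<epsilon>}"
  assumes lam: "lam > 1" and eps: "\<epsilon> > 0"
    and f_C3: "\<forall>t\<in>I. C_k 3 (f t) \<and> is_lift (f t)"
    and f_path: "C2_path_in_Ck 3 f I"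
    and f_expanding: "\<forall>t\<in>I. \<forall>x. \<bar>deriv (f t) x\<bar> \<ge> lam"
    and f_lip: "\<exists>C. \<forall>t\<in>I. \<forall>s\<in>I. Ck_norm 3 (\<lambda>x. f t x - f s x) \<le> C * \<bar>t - s\<bar>"
    and rho_C2: "\<forall>t\<in>I. C_k 2 (\<rho> t) \<and> periodic1 (\<rho> t)"
    and rho_prob: "\<forall>t\<in>I. (\<forall>x. \<rho> t x \<ge> 0) \<and> integral {0..1} (\<rho> t) = 1"
    and rho_inv: "\<forall>t\<in>I. \<forall>\<phi>. continuous_on UNIV \<phi> \<and> periodic1 \<phi> \<longrightarrow>
                    integral {0..1} (\<lambda>x. \<phi> (f t x) * \<rho> t x) = integral {0..1} (\<lambda>x. \<phi> x * \<rho> t x)"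
    and X_C2: "\<forall>t\<in>I. C_k 2 (X t) \<and> periodic1 (X t)"
    and X_v: "\<forall>t\<in>I. \<forall>x. ((\<lambda>s. f s x) has_real_derivative X t (f t x)) (at t)"
  shows "\<forall>t\<in>I. has_Ck_path_deriv 1 \<rho>
            (\<lambda>x. - zero_mean_inverse (transfer (f t)) (deriv (\<lambda>y. X t y * \<rho> t y)) x) t I"
proof
  fix t assume t: "t \<in> I"
  have I: "open I" "convex I" "0 \<in> I"
    using eps by (auto simp: I_def)
  have fC: "C_k 3 (f s)" and fl: "is_lift (f s)" and fe: "lam \<le> \<bar>deriv (f s) x\<bar>" if "s \<in> I" for s x
    using f_C3 f_expanding that by auto
  have fD: "(f s has_real_derivative deriv (f s) x) (at x)"
    "(deriv (f s) has_real_derivative (deriv ^^ 2) (f s) x) (at x)"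
    "((deriv ^^ 2) (f s) has_real_derivative (deriv ^^ 3) (f s) x) (at x)" if "s \<in> I" for s x
    using C_k_DERIV[OF fC[OF that], of 0 x] C_k_DERIV[OF fC[OF that], of 1 x] C_k_DERIV[OF fC[OF that], of 2 x]
    by (simp_all add: numeral_2_eq_2 numeral_3_eq_3)
  have fc: "continuous_on UNIV (deriv (f s))" "continuous_on UNIV ((deriv ^^ 2) (f s))" if "s \<in> I" for s
    using C_k_continuous[OF fC[OF that], of 1] C_k_continuous[OF fC[OF that], of 2] by simp_all
  \<comment> \<open>Orientation and degree are read off at the parameter \<open>0\<close> and then
    carried to all of \<open>I\<close>.\<close>
  obtain \<sigma> N where sN: "\<sigma> = 1 \<or> \<sigma> = (- 1::real)" "0 < N" "\<And>x. f 0 (x + 1) = f 0 x + \<sigma> * real N"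
    using expanding_lift_exists_sign[OF fl[OF I(3)] fD(1)[OF I(3)] fc(1)[OF I(3)] fe[OF I(3)] lam] by metis

  \<comment> \<open>The degree is locally constant: the velocity at \<open>x + 1\<close> and at \<open>x\<close> is the same value of \<open>X s\<close>.\<close>
  have shift: "f s (x + 1) = f s x + \<sigma> * real N" if s: "s \<in> I" for s x
  proof -
    have "((\<lambda>s. f s (x + 1) - f s x) has_real_derivative 0) (at u within I)" if u: "u \<in> I" for u
    proof -
      obtain d :: int where d: "f u (x + 1) = f u x + of_int d"
        using fl[OF u] by (auto simp: is_lift_def)
      have "X u (f u (x + 1)) = X u (f u x)"
        using X_C2 u periodic1_add_int[of "X u" "f u x" d] by (simp add: d)
      moreover have "((\<lambda>s. f s (x + 1) - f s x) has_real_derivative X u (f u (x + 1)) - X u (f u x)) (at u)"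
        using X_v u by (intro DERIV_diff) auto
      ultimately show ?thesis
        by (simp add: has_field_derivative_at_within)
    qed
    from has_field_derivative_zero_constant[OF I(2) this]
    obtain c where "\<And>s. s \<in> I \<Longrightarrow> f s (x + 1) - f s x = c"
      by blast
    from this[OF s] this[OF I(3)] sN(3)[of x] show ?thesis
      by simp
  qed
  have expand: "lam \<le> \<sigma> * deriv (f s) x" if s: "s \<in> I" for s x
  proof -
    obtain \<sigma>' N' where *: "\<sigma>' = 1 \<or> \<sigma>' = (- 1::real)" "0 < N'" "\<And>x. f s (x + 1) = f s x + \<sigma>' * real N'"
      "\<And>x. lam \<le> \<sigma>' * deriv (f s) x"
      using expanding_lift_exists_sign[OF fl[OF s] fD(1)[OF s] fc(1)[OF s] fe[OF s] lam] by metis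
    \<comment> \<open>Equal degrees with \<open>N\<close> and \<open>N'\<close> positive have equal
      signs.\<close>
    have "\<sigma>' * real N' = \<sigma> * real N"
      using *(3)[of 0] shift[OF s, of 0] by simp
    then have "\<sigma>' = \<sigma>"
      using *(1,2) sN(1,2) by auto
    then show ?thesis
      using *(4) by simp
  qed
  have diff_per: "periodic1 (\<lambda>x. f s x - f u x)" if "s \<in> I" "u \<in> I" for s u
    using that by (simp add: periodic1_def shift)
  \<comment> \<open>A bound common to all parameters comes from comparison with \<open>f 0\<close>:
    the Lipschitz hypothesis and \<open>\<bar>s\<bar> < \<epsilon>\<close> control the
    difference.\<close>
  obtain B where B: "\<And>s x. s \<in> I \<Longrightarrow> \<bar>(deriv ^^ 2) (f s) x\<bar> \<le> B"
  proof -
    obtain C where C: "\<And>s. s \<in> I \<Longrightarrow> Ck_norm 3 (\<lambda>x. f s x - f 0 x) \<le> C * \<bar>s - 0\<bar>"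
      using f_lip I(3) by blast
    have "periodic1 ((deriv ^^ 2) (f 0))"
      using periodic1_deriv[OF periodic1_imp_is_lift[OF periodic1_deriv[OF fl fD(1)]] fD(2)] I(3) by blast
    then obtain b where b: "\<And>x. \<bar>(deriv ^^ 2) (f 0) x\<bar> \<le> b"
      using periodic1_bounded[OF fc(2)[OF I(3)]] by blast
    have "\<bar>(deriv ^^ 2) (f s) x\<bar> \<le> b + \<bar>C\<bar> * \<epsilon>" if s: "s \<in> I" for s x
    proof -
      note c = C_k_lincomb[OF fC[OF s] fC[OF I(3)], where a=1 and b="- 1", simplified]
      have "\<bar>(deriv ^^ 2) (f s) x - (deriv ^^ 2) (f 0) x\<bar> \<le> Ck_norm 3 (\<lambda>x. f s x - f 0 x)"
        using Ck_norm_ge[OF c(1) diff_per[OF s I(3)], of 2 x] c(2)[of 2] by simp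
      also have "\<dots> \<le> C * \<bar>s - 0\<bar>"
        by (rule C[OF s])
      also have "\<dots> \<le> \<bar>C\<bar> * \<epsilon>"
        using s by (intro mult_mono) (auto simp: I_def)
      finally show ?thesis
        using b[of x] by linarith
    qed
    then show ?thesis
      using that by blast
  qed
  have lift: "expanding_lift (f s) (deriv (f s)) ((deriv ^^ 2) (f s)) \<sigma> lam B N" if s: "s \<in> I" for s
    by unfold_locales (use fD[OF s] fc[OF s] shift[OF s] sN(1) lam expand[OF s] B[OF s] in auto)
  obtain q r where qr: "\<And>s. s \<in> I \<Longrightarrow> C_k 3 (q s) \<and> periodic1 (q s) \<and> C_k 3 (r s) \<and> periodic1 (r s)
      \<and> has_Ck_path_deriv 3 f (q s) s I \<and> has_Ck_path_deriv 3 q (r s) s I"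
    using f_path unfolding C2_path_in_Ck_def by blast
  have path_f: "u \<in> I \<Longrightarrow> ((\<lambda>s. (deriv ^^ j) (f s) x) has_real_derivative (deriv ^^ j) (q u) x) (at u)"
    "continuous_on (I \<times> UNIV) (\<lambda>(s, x). (deriv ^^ j) (f s) x)" if "j \<le> 3" for j u x
    using qr fC diff_per that by (blast intro: path_deriv_strip[OF I(1), where p=f and Q=q and k=3])+
  have "periodic1 (\<lambda>x. q s x - q u x)" if "s \<in> I" "u \<in> I" for s u
    using qr[OF that(1)] qr[OF that(2)] by (simp add: periodic1_def)
  then have path_q: "continuous_on (I \<times> UNIV) (\<lambda>(s, x). (deriv ^^ j) (q s) x)" if "j \<le> 3" for j
    using qr that by (blast intro: path_deriv_strip(2)[OF I(1), where p=q and Q=r and k=3])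
  have strip: "C1_on_strip I (\<lambda>s. (deriv ^^ j) (f s)) (\<lambda>s. (deriv ^^ j) (q s)) (\<lambda>s. (deriv ^^ Suc j) (f s))"
    if "j < 3" for j
    unfolding C1_on_strip_def
    using path_f[of j] path_f(2)[of "Suc j"] path_q[of j] C_k_DERIV[OF fC that] that by simp
  interpret expanding_family I f "\<lambda>s. deriv (f s)" "\<lambda>s. (deriv ^^ 2) (f s)" "\<lambda>s. (deriv ^^ 3) (f s)"
    q "\<lambda>s. deriv (q s)" "\<lambda>s. (deriv ^^ 2) (q s)" \<sigma> lam B N
    using I(1) lift strip[of 0] strip[of 1] strip[of 2]
    by (intro expanding_family.intro) (simp_all add: numeral_2_eq_2 numeral_3_eq_3)
  note \<rho>_C1 = C_k_2_imp_C1_periodic[of "\<rho> _"] and X_C1 = C_k_2_imp_C1_periodic[of "X t"]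
  \<comment> \<open>The velocity of the path in \<open>C^3\<close> and the given vector field both
    differentiate \<open>f s y\<close> in \<open>s\<close> at \<open>t\<close>.\<close>
  have "q t y = X t (f t y)" for y
    using path_f(1)[OF le0 t, of y] X_v t by (auto intro: DERIV_unique)
  moreover have "LL s (\<rho> s) = \<rho> s" if s: "s \<in> I" for s
    using rho_C2 rho_inv s
    by (intro expanding_lift.invariant_density_fixed[OF lift[OF s]] C1_periodic_imp_continuous \<rho>_C1) auto
  ultimately show "has_Ck_path_deriv 1 \<rho>
      (\<lambda>x. - zero_mean_inverse (transfer (f t)) (deriv (\<lambda>y. X t y * \<rho> t y)) x) t I"
    using rho_C2 rho_prob X_C2 t by (intro linear_response_of_family \<rho>_C1 X_C1) auto
qed

end
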